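(* Let $T=[a_1,b_1]\times\cdots\times[a_n,b_n]\subset\mathbb R^n$ be a closed brick and let $\Sigma$ be the family of all closed bricks contained in $T$. A function $\Psi:\Sigma\to\mathbb R$ is the indefinite integral of a suitable K-integrable function $f:T\to\mathbb R$ (that is, $\Psi(S)=\int_S f$ for every $S\in\Sigma$) if and only if $\Psi$ has the following properties: (1) $\Psi$ is a Lipschitz function, i.e., there exists $L>0$ such that $|\Psi(S)|\le L\cdot\lambda(S)$ for every $S\in\Sigma$; (2) $\Psi$ is finitely additive; (3) $\Psi$ is strongly differentiable Lebesgue almost everywhere (in $T$); (4) $\Psi$ is strongly differentiable in every direction $\alpha\in\{-1,1\}^n$ Jordan almost everywhere, i.e. the set of points $u\in T$ for which there is some $\alpha\in\{-1,1\}^n$ such that $\Psi'_\alpha(u)$ does not exist is a Jordan null set.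
   Context: Fix a positive integer $n$. A brick is a product $I_1\times\cdots\times I_n$ of $n$ bounded (nonempty) intervals (open, closed or half-open, possibly degenerate); its volume $\lambda$ is the product of the lengths of the intervals. For a closed brick $S$, a step function on $S$ is a finite linear combination $g=\sum_{j=1}^M c_j\chi_{T_j}$ of characteristic functions of bricks $T_j\subset S$; its integral is $\int_S g=\sum_j c_j\lambda(T_j)$. A sequence of functions $f_m:S\to\mathbb R$ converges nearly uniformly to $f:S\to\mathbb R$ if (i) the sequence $(f_m)$ is uniformly bounded on $S$, and (ii) for every $\delta>0$ there exist finitely many bricks contained in $S$, of total volume less than $\delta$, such that $f_m$ converges uniformly to $f$ on the complement (in $S$) of their union. A function $f:S\to\mathbb R$ is K-integrable if there is a sequence $(g_m)$ of step functions on $S$ converging nearly uniformly to $f$; its K-integral is then $\int_S f:=\lim_{m\to\infty}\int_S g_m$ (the limit exists and does not depend on the choice of $(g_m)$). $\Sigma=\{[\alpha_1,\beta_1]\times\cdots\times[\alpha_n,\beta_n]: a_i\le\alpha_i\le\beta_i\le b_i,\ i=1,\dots,n\}$. If $f:T\to\mathbb R$ is K-integrable, then $f|_S$ is K-integrable for all $S\in\Sigma$, and the indefinite integral of $f$ is the set function $S\mapsto\int_S f$ (meaning $\int_S f|_S$) on $\Sigma$. $\Psi:\Sigma\to\mathbb R$ is finitely additive if $\Psi(S)=\sum_{i=1}^m\Psi(S_i)$ whenever $S,S_1,\dots,S_m\in\Sigma$, $S=\bigcup_{i=1}^m S_i$ and $\mathrm{int}(S_i)\cap\mathrm{int}(S_j)=\emptyset$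 for $i\ne j$. $B(u,\delta)$ is the open ball of center $u$ and radius $\delta$. $\Psi$ is strongly differentiable at $u\in\mathrm{int}(T)$ with strong derivative $\Psi'(u)=t\in\mathbb R$ if for every $\varepsilon>0$ there exists $\delta>0$ such that $\left|\Psi(S)/\lambda(S)-t\right|<\varepsilon$ for every $S\in\Sigma$ with $\lambda(S)>0$ and $S\subset B(u,\delta)$. For $\alpha\in\{-1,1\}^n$ and $u\in\mathrm{int}(T)$ let $T_{u,\alpha}=I_1\times\cdots\times I_n$ with $I_k=[a_k,u_k)$ if $\alpha_k=-1$ and $I_k=(u_k,b_k]$ if $\alpha_k=1$; $\Psi$ is strongly differentiable at $u$ in direction $\alpha$ with strong derivative $\Psi'_\alpha(u)=t\in\mathbb R$ if for every $\varepsilon>0$ there exists $\delta>0$ such that $\left|\Psi(S)/\lambda(S)-t\right|<\varepsilon$ for every $S\in\Sigma$ with $\lambda(S)>0$ and $S\subset B(u,\delta)\cap\overline{T_{u,\alpha}}$. A set is a Jordan null set if for each $\varepsilon>0$ it can be covered by finitely many bricks of total volume less than $\varepsilon$; a property holds Jordan almost everywhere if it holds outside a Jordan null set. *)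

theory Defs
  imports "HOL-Analysis.Analysis"
begin

text \<open>
  The dimension is the cardinality of the index type. A function on a set \<open>S\<close> is represented by a
  total function of which only the values on \<open>S\<close> are ever used; likewise a set function on the
  closed bricks inside \<open>T\<close> is a total function on sets of which only those values are used.
\<close>

definition is_brick :: "(real ^ 'n) set \<Rightarrow> bool" where
  "is_brick B \<longleftrightarrow>
    (\<exists>I :: 'n \<Rightarrow> real set.
      (\<forall>i. is_interval (I i) \<and> bounded (I i) \<and> I i \<noteq> {}) \<and> B = {x. \<forall>i. x $ i \<in> I i})"

text \<open>The factors of a (nonempty) brick are its coordinate projections.\<close>

definition brick_volume :: "(real ^ 'n) set \<Rightarrow> real" where
  "brick_volume B = (\<Prod>i\<in>UNIV. Sup ((\<lambda>x. x $ i) ` B) - Inf ((\<lambda>x. x $ i) ` B))"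

definition step_representation ::
    "(real ^ 'n) set \<Rightarrow> (real ^ 'n \<Rightarrow> real) \<Rightarrow> nat \<Rightarrow> (nat \<Rightarrow> real) \<Rightarrow> (nat \<Rightarrow> (real ^ 'n) set) \<Rightarrow> bool"
  where
  "step_representation S g M c B \<longleftrightarrow>
    (\<forall>j<M. is_brick (B j) \<and> B j \<subseteq> S) \<and>
    (\<forall>x\<in>S. g x = (\<Sum>j<M. c j * indicator (B j) x))"

definition step_function_on :: "(real ^ 'n) set \<Rightarrow> (real ^ 'n \<Rightarrow> real) \<Rightarrow> bool" where
  "step_function_on S g \<longleftrightarrow> (\<exists>M c B. step_representation S g M c B)"

text \<open>The value does not depend on the chosen representation.\<close>

definition step_integral :: "(real ^ 'n) set \<Rightarrow> (real ^ 'n \<Rightarrow> real) \<Rightarrow> real" where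
  "step_integral S g =
    (THE I. \<exists>M c B. step_representation S g M c B \<and> I = (\<Sum>j<M. c j * brick_volume (B j)))"

definition nearly_uniform_limit ::
    "(real ^ 'n) set \<Rightarrow> (nat \<Rightarrow> real ^ 'n \<Rightarrow> real) \<Rightarrow> (real ^ 'n \<Rightarrow> real) \<Rightarrow> bool" where
  "nearly_uniform_limit S F f \<longleftrightarrow>
    (\<exists>K. \<forall>m. \<forall>x\<in>S. \<bar>F m x\<bar> \<le> K) \<and>
    (\<forall>\<delta>>0. \<exists>\<B>. finite \<B> \<and> (\<forall>B\<in>\<B>. is_brick B \<and> B \<subseteq> S) \<and>
       (\<Sum>B\<in>\<B>. brick_volume B) < \<delta> \<and> uniform_limit (S - \<Union>\<B>) F f sequentially)"

definition K_integrable_on :: "(real ^ 'n \<Rightarrow> real) \<Rightarrow> (real ^ 'n) set \<Rightarrow> bool"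
    (infixr \<open>K'_integrable'_on\<close> 46) where
  "f K_integrable_on S \<longleftrightarrow>
    (\<exists>g. (\<forall>m. step_function_on S (g m)) \<and> nearly_uniform_limit S g f)"

text \<open>The limit exists and is the same for every approximating sequence of step functions.\<close>

definition K_integral :: "(real ^ 'n) set \<Rightarrow> (real ^ 'n \<Rightarrow> real) \<Rightarrow> real" where
  "K_integral S f =
    (THE I. \<exists>g. (\<forall>m. step_function_on S (g m)) \<and> nearly_uniform_limit S g f \<and>
       (\<lambda>m. step_integral S (g m)) \<longlonglongrightarrow> I)"

definition closed_subbricks :: "real ^ 'n \<Rightarrow> real ^ 'n \<Rightarrow> (real ^ 'n) set set" where
  "closed_subbricks a b =
    {cbox \<alpha> \<beta> | \<alpha> \<beta>. \<forall>i. a $ i \<le> \<alpha> $ i \<and> \<alpha> $ i \<le> \<beta> $ i \<and> \<beta> $ i \<le> b $ i}"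

definition finitely_additive ::
    "real ^ 'n \<Rightarrow> real ^ 'n \<Rightarrow> ((real ^ 'n) set \<Rightarrow> real) \<Rightarrow> bool" where
  "finitely_additive a b \<Psi> \<longleftrightarrow>
    (\<forall>S m P. S \<in> closed_subbricks a b \<and>
       (\<forall>i\<in>{1..m::nat}. P i \<in> closed_subbricks a b) \<and>
       S = (\<Union>i\<in>{1..m}. P i) \<and>
       (\<forall>i\<in>{1..m}. \<forall>j\<in>{1..m}. i \<noteq> j \<longrightarrow> interior (P i) \<inter> interior (P j) = {})
       \<longrightarrow> \<Psi> S = (\<Sum>i=1..m. \<Psi> (P i)))"

definition brick_lipschitz ::
    "real ^ 'n \<Rightarrow> real ^ 'n \<Rightarrow> ((real ^ 'n) set \<Rightarrow> real) \<Rightarrow> bool" where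
  "brick_lipschitz a b \<Psi> \<longleftrightarrow>
    (\<exists>L>0. \<forall>S\<in>closed_subbricks a b. \<bar>\<Psi> S\<bar> \<le> L * brick_volume S)"

definition has_strong_derivative ::
    "real ^ 'n \<Rightarrow> real ^ 'n \<Rightarrow> ((real ^ 'n) set \<Rightarrow> real) \<Rightarrow> real ^ 'n \<Rightarrow> real \<Rightarrow> bool" where
  "has_strong_derivative a b \<Psi> u t \<longleftrightarrow>
    u \<in> interior (cbox a b) \<and>
    (\<forall>\<epsilon>>0. \<exists>\<delta>>0. \<forall>S\<in>closed_subbricks a b.
       brick_volume S > 0 \<and> S \<subseteq> ball u \<delta> \<longrightarrow> \<bar>\<Psi> S / brick_volume S - t\<bar> < \<epsilon>)"

definition strongly_differentiable ::
    "real ^ 'n \<Rightarrow> real ^ 'n \<Rightarrow> ((real ^ 'n) set \<Rightarrow> real) \<Rightarrow> real ^ 'n \<Rightarrow> bool" where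
  "strongly_differentiable a b \<Psi> u \<longleftrightarrow> (\<exists>t. has_strong_derivative a b \<Psi> u t)"

definition directions :: "(int ^ 'n) set" where
  "directions = {\<alpha>. \<forall>k. \<alpha> $ k \<in> {-1, 1}}"

definition quadrant ::
    "real ^ 'n \<Rightarrow> real ^ 'n \<Rightarrow> real ^ 'n \<Rightarrow> int ^ 'n \<Rightarrow> (real ^ 'n) set" where
  "quadrant a b u \<alpha> =
    {x. \<forall>k. x $ k \<in> (if \<alpha> $ k = -1 then {a $ k ..< u $ k} else {u $ k <.. b $ k})}"

definition has_strong_derivative_dir ::
    "real ^ 'n \<Rightarrow> real ^ 'n \<Rightarrow> ((real ^ 'n) set \<Rightarrow> real) \<Rightarrow> int ^ 'n \<Rightarrow> real ^ 'n \<Rightarrow> real \<Rightarrow> bool" where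
  "has_strong_derivative_dir a b \<Psi> \<alpha> u t \<longleftrightarrow>
    u \<in> interior (cbox a b) \<and>
    (\<forall>\<epsilon>>0. \<exists>\<delta>>0. \<forall>S\<in>closed_subbricks a b.
       brick_volume S > 0 \<and> S \<subseteq> ball u \<delta> \<inter> closure (quadrant a b u \<alpha>)
       \<longrightarrow> \<bar>\<Psi> S / brick_volume S - t\<bar> < \<epsilon>)"

definition strongly_differentiable_dir ::
    "real ^ 'n \<Rightarrow> real ^ 'n \<Rightarrow> ((real ^ 'n) set \<Rightarrow> real) \<Rightarrow> int ^ 'n \<Rightarrow> real ^ 'n \<Rightarrow> bool" where
  "strongly_differentiable_dir a b \<Psi> \<alpha> u \<longleftrightarrow> (\<exists>t. has_strong_derivative_dir a b \<Psi> \<alpha> u t)"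

definition jordan_null :: "(real ^ 'n) set \<Rightarrow> bool" where
  "jordan_null A \<longleftrightarrow>
    (\<forall>\<epsilon>>0. \<exists>\<B>. finite \<B> \<and> (\<forall>B\<in>\<B>. is_brick B) \<and> A \<subseteq> \<Union>\<B> \<and>
       (\<Sum>B\<in>\<B>. brick_volume B) < \<epsilon>)"

end

(*
  On a closed brick S the K-integral is the Henstock-Kurzweil integral, by dominated convergence, as
  nearly uniform convergence implies convergence almost everywhere.

  Let f be K-integrable, approximated by step functions g_m. Near a point u outside a Jordan null
  set the g_m converge uniformly, and each g_m is constant near u on every open quadrant with vertex
  u, so the averages of f over small bricks in a closed quadrant form a Cauchy net. If moreover u
  avoids the frontiers of the countably many bricks used by the g_m, then each g_m is constant on a
  full neighbourhood of u, and the averages converge without restriction to a quadrant.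

  Conversely, let N be the exceptional Jordan null set of condition (4), and let f be the strong
  derivative of Psi in the direction (1,...,1). For u outside N and a direction alpha, the value of f
  at a point v of the half-open quadrant belonging to alpha is close to Psi'_alpha(u), since small
  bricks with lower corner v lie in that closed quadrant of u. By compactness f is, on the points at
  distance at least 1/m from N, within 1/m of a step function on a finite half-open grid, hence f is
  K-integrable. Where Psi is strongly differentiable its derivative is f, and comparing Riemann sums
  over fine tagged divisions with the additive function Psi shows that f has integral Psi.
*)

theory Submission
  imports Defs
begin

section \<open>Bricks\<close>

lemma is_brickE:
  assumes "is_brick B"
  obtains I where "\<And>i. is_interval (I i)" "\<And>i. bounded (I i)" "\<And>i. I i \<noteq> {}"
    "B = {x. \<forall>i. x $ i \<in> I i}"
proof -
  from assms obtain I
    where "(\<forall>i. is_interval (I i) \<and> bounded (I i) \<and> I i \<noteq> {}) \<and> B = {x. \<forall>i. x $ i \<in> I i}"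
    unfolding is_brick_def ..
  then show thesis by (intro that) simp_all
qed

lemma is_brickI:
  assumes "\<And>i. is_interval (I i)" "\<And>i. bounded (I i)" "\<And>i. I i \<noteq> {}"
  shows "is_brick {x. \<forall>i. x $ i \<in> I i}"
  unfolding is_brick_def by (intro exI[of _ I]) (simp add: assms)

text \<open>With the infima and suprema of the factors as corners, \<open>B\<close> differs from a
  box only in boundary points. So, whichever endpoints the factors contain, questions of measure
  reduce to boxes. For a degenerate brick the open box is empty.\<close>

lemma brick_sandwich:
  fixes B :: "(real ^ 'n) set"
  assumes "is_brick B"
  obtains l h where "\<And>i. l $ i \<le> h $ i" "box l h \<subseteq> B" "B \<subseteq> cbox l h"
    "brick_volume B = (\<Prod>i\<in>UNIV. h $ i - l $ i)"
proof -
  obtain I :: "'n \<Rightarrow> real set" where I: "\<And>i. is_interval (I i)" "\<And>i. bounded (I i)" "\<And>i. I i \<noteq> {}"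
    and B: "B = {x. \<forall>i. x $ i \<in> I i}"
    by (rule is_brickE[OF assms]) (rule that)
  have proj: "(\<lambda>x. x $ i) ` B = I i" for i
  proof (intro subset_antisym subsetI)
    fix y assume y: "y \<in> I i"
    \<comment> \<open>The other factors are nonempty, so a point with \<open>i\<close>-th coordinate
      \<open>y\<close> can be completed inside \<open>B\<close>.\<close>
    have "(\<chi> j. if j = i then y else (SOME z. z \<in> I j)) \<in> B"
      using y by (simp add: B some_in_eq I(3))
    then show "y \<in> (\<lambda>x. x $ i) ` B"
      by (rule rev_image_eqI) simp
  qed (auto simp: B)
  define l h where "l = (\<chi> i. Inf (I i))" and "h = (\<chi> i. Sup (I i))"
  have bd: "bdd_below (I i)" "bdd_above (I i)" for i
    by (simp_all add: I(2) bounded_imp_bdd_below bounded_imp_bdd_above)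
  show thesis
  proof
    show "l $ i \<le> h $ i" for i
      unfolding l_def h_def by (simp add: cInf_le_cSup I(3) bd)
    show "B \<subseteq> cbox l h"
      by (simp add: B l_def h_def mem_box_cart subset_iff cInf_lower cSup_upper bd)
    show "box l h \<subseteq> B"
    proof
      fix x assume x: "x \<in> box l h"
      have "x $ i \<in> I i" for i
      proof -
        have "Inf (I i) < x $ i" "x $ i < Sup (I i)"
          using x by (auto simp: l_def h_def mem_box_cart)
        then obtain p q where pq: "p \<in> I i" "p < x $ i" "q \<in> I i" "x $ i < q"
          using cInf_less_iff[OF I(3) bd(1), of i "x $ i"] less_cSup_iff[OF I(3) bd(2), of "x $ i" i]
          by blast
        show ?thesis
          using I(1)[of i, unfolded is_interval_1, rule_format, OF pq(1,3)] pq(2,4) by simp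
      qed
      then show "x \<in> B" by (simp add: B)
    qed
    show "brick_volume B = (\<Prod>i\<in>UNIV. h $ i - l $ i)"
      by (simp add: brick_volume_def proj l_def h_def)
  qed
qed

text \<open>Both \<open>B - box l h\<close> and \<open>frontier B\<close> lie in
  \<open>cbox l h - box l h\<close>, which is negligible even for a degenerate box. Hence
  \<open>B\<close> has the measure of its closed box.\<close>

lemma
  assumes "is_brick B"
  shows lmeasurable_brick: "B \<in> lmeasurable"
    and measure_brick: "measure lebesgue B = brick_volume B"
    and negligible_frontier_brick: "negligible (frontier B)"
proof -
  obtain l h where lh: "\<And>i. l $ i \<le> h $ i" "box l h \<subseteq> B" "B \<subseteq> cbox l h"
    "brick_volume B = (\<Prod>i\<in>UNIV. h $ i - l $ i)"
    using brick_sandwich[OF assms] by blast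
  have ne: "cbox l h \<noteq> {}"
    using lh(1) by (simp add: interval_ne_empty_cart)
  have neg: "negligible (cbox l h - box l h)"
    using negligible_frontier_interval[of l h] by simp
  have B_eq: "B = box l h \<union> (B - box l h)"
    using lh by blast
  have negB: "negligible (B - box l h)"
    by (rule negligible_subset[OF neg]) (use lh in auto)
  show "B \<in> lmeasurable"
    by (subst B_eq) (intro fmeasurable.Un lmeasurable_box negligible_imp_measurable negB)
  have "(cbox l h - B) \<union> (B - cbox l h) \<subseteq> cbox l h - box l h"
    using lh(2,3) by blast
  then have "measure lebesgue B = measure lebesgue (cbox l h)"
    by (intro measure_negligible_symdiff negligible_subset[OF neg]) auto
  then show "measure lebesgue B = brick_volume B"
    unfolding lh(4) content_cbox_cart[OF ne, symmetric] by simp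
  have "frontier B \<subseteq> cbox l h - box l h"
    unfolding frontier_def
    by (intro Diff_mono closure_minimal interior_maximal lh closed_cbox open_box)
  then show "negligible (frontier B)"
    by (rule negligible_subset[OF neg])
qed

lemma brick_volume_nonneg: "is_brick B \<Longrightarrow> 0 \<le> brick_volume B"
  by (simp flip: measure_brick)

lemma brick_volume_mono:
  "is_brick A \<Longrightarrow> is_brick B \<Longrightarrow> A \<subseteq> B \<Longrightarrow> brick_volume A \<le> brick_volume B"
  using measure_mono_fmeasurable[of A B lebesgue]
  by (simp add: measure_brick lmeasurable_brick fmeasurableD)

lemma is_brick_Int:
  fixes A B :: "(real ^ 'n) set"
  assumes "is_brick A" "is_brick B" "A \<inter> B \<noteq> {}"
  shows "is_brick (A \<inter> B)"
proof -
  obtain I where I: "\<And>i. is_interval (I i)" "\<And>i. bounded (I i)" "A = {x. \<forall>i. x $ i \<in> I i}"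
    by (rule is_brickE[OF assms(1)]) (rule that)
  obtain J where J: "\<And>i. is_interval (J i)" "\<And>i. bounded (J i)" "B = {x. \<forall>i. x $ i \<in> J i}"
    by (rule is_brickE[OF assms(2)]) (rule that)
  have "I i \<inter> J i \<noteq> {}" for i
    using assms(3) by (auto simp: I(3) J(3))
  then show ?thesis
    unfolding is_brick_def
    by (intro exI[of _ "\<lambda>i. I i \<inter> J i"]) (auto simp: is_interval_Int bounded_Int I J)
qed

lemma is_brick_cbox:
  fixes a b :: "real ^ 'n"
  assumes "\<And>i. a $ i \<le> b $ i"
  shows "is_brick (cbox a b)"
  unfolding is_brick_def
  by (intro exI[of _ "\<lambda>i. {a $ i..b $ i}"]) (auto simp: mem_box_cart assms is_interval_cc)

text \<open>Trades coordinate inequalities for inclusion of sets, the form in which pieces of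
  divisions and small test bricks are recognised as members of the family.\<close>

lemma closed_subbricks_iff:
  "S \<in> closed_subbricks a b \<longleftrightarrow> (\<exists>\<alpha> \<beta>. S = cbox \<alpha> \<beta> \<and> cbox \<alpha> \<beta> \<noteq> {}) \<and> S \<subseteq> cbox a b"
  (is "?L \<longleftrightarrow> ?R")
proof
  assume ?L
  then obtain \<alpha> \<beta> where "\<forall>i. a $ i \<le> \<alpha> $ i \<and> \<alpha> $ i \<le> \<beta> $ i \<and> \<beta> $ i \<le> b $ i" and S: "S = cbox \<alpha> \<beta>"
    unfolding closed_subbricks_def by blast
  then show ?R
    unfolding S by (auto simp only: interval_ne_empty_cart subset_interval_cart)
next
  assume ?R
  then obtain \<alpha> \<beta> where S: "S = cbox \<alpha> \<beta>" "cbox \<alpha> \<beta> \<noteq> {}" "cbox \<alpha> \<beta> \<subseteq> cbox a b" by blast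
  then have "\<forall>i. \<alpha> $ i \<le> \<beta> $ i"
    by (simp add: interval_ne_empty_cart)
  moreover from this S(3) have "\<forall>i. a $ i \<le> \<alpha> $ i \<and> \<beta> $ i \<le> b $ i"
    by (simp add: subset_interval_cart)
  ultimately show ?L
    unfolding closed_subbricks_def S(1) by blast
qed

lemma closed_subbricks_brick: "S \<in> closed_subbricks a b \<Longrightarrow> is_brick S"
  by (auto simp: closed_subbricks_def intro!: is_brick_cbox)

lemma closed_subbricks_content: "S \<in> closed_subbricks a b \<Longrightarrow> measure lborel S = brick_volume S"
  using measure_brick[OF closed_subbricks_brick, of S a b]
  by (auto simp: closed_subbricks_def measure_completion)

section \<open>The K-integral as a Henstock-Kurzweil integral\<close>

lemma
  assumes "finite \<B>" "\<And>B. B \<in> \<B> \<Longrightarrow> is_brick B"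
  shows lmeasurable_Union_bricks: "\<Union>\<B> \<in> lmeasurable"
    and measure_Union_bricks_le: "measure lebesgue (\<Union>\<B>) \<le> (\<Sum>B\<in>\<B>. brick_volume B)"
proof -
  show "\<Union>\<B> \<in> lmeasurable"
    using assms by (intro fmeasurable.finite_Union) (auto intro: lmeasurable_brick)
  have "measure lebesgue (\<Union>\<B>) \<le> sum (measure lebesgue) \<B>"
    using assms by (intro measure_Union_le) (auto intro!: fmeasurableD lmeasurable_brick)
  also have "\<dots> = (\<Sum>B\<in>\<B>. brick_volume B)"
    using assms by (intro sum.cong) (auto intro: measure_brick)
  finally show "measure lebesgue (\<Union>\<B>) \<le> (\<Sum>B\<in>\<B>. brick_volume B)" .
qed

section \<open>Step functions and their integrals\<close>

lemma indicator_brick_has_integral: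
  assumes "is_brick B" "B \<subseteq> S"
  shows "((indicator B :: _ \<Rightarrow> real) has_integral brick_volume B) S"
proof -
  have "((indicator B :: _ \<Rightarrow> real) has_integral brick_volume B) UNIV"
    using lmeasurable_brick[OF assms(1)] measure_brick[OF assms(1)]
    by (simp add: lmeasurable_iff_has_integral)
  then have "((\<lambda>x. if x \<in> S then indicator B x :: real else 0) has_integral brick_volume B) UNIV"
    by (rule has_integral_eq[rotated]) (use assms(2) in \<open>auto simp: indicator_def\<close>)
  then show ?thesis
    by (simp only: has_integral_restrict_UNIV)
qed

lemma step_representation_has_integral:
  assumes "step_representation S g M c B"
  shows "(g has_integral (\<Sum>j<M. c j * brick_volume (B j))) S"
proof (rule has_integral_eq)
  show "((\<lambda>x. \<Sum>j<M. c j * indicator (B j) x) has_integral (\<Sum>j<M. c j * brick_volume (B j))) S"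
    using assms unfolding step_representation_def
    by (intro has_integral_sum has_integral_mult_right indicator_brick_has_integral) auto
  show "\<And>x. x \<in> S \<Longrightarrow> (\<Sum>j<M. c j * indicator (B j) x) = g x"
    using assms unfolding step_representation_def by simp
qed

text \<open>The sum of every representation is the Henstock-Kurzweil integral of the same function,
  so uniqueness of that integral shows that the definite description in \<open>step_integral\<close>
  is well defined.\<close>

lemma step_function_has_integral:
  assumes "step_function_on S g"
  shows "(g has_integral step_integral S g) S"
proof -
  obtain M c B where B: "step_representation S g M c B"
    using assms unfolding step_function_on_def by blast
  have "step_integral S g = (\<Sum>j<M. c j * brick_volume (B j))"
    unfolding step_integral_def
  proof (rule the_equality)
    fix I assume "\<exists>M c B. step_representation S g M c B \<and> I = (\<Sum>j<M. c j * brick_volume (B j))"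
    then have "(g has_integral I) S"
      by (elim exE conjE) (simp add: step_representation_has_integral)
    then show "I = (\<Sum>j<M. c j * brick_volume (B j))"
      by (rule has_integral_unique) (rule step_representation_has_integral[OF B])
  qed (intro exI conjI, rule B, rule refl)
  then show ?thesis
    using step_representation_has_integral[OF B] by simp
qed

text \<open>Permits any finite index set, such as a set of grid cells, by enumerating it with an
  initial segment of the naturals.\<close>

lemma step_function_onI:
  assumes "finite A" "\<And>k. k \<in> A \<Longrightarrow> is_brick (C k) \<and> C k \<subseteq> S"
    "\<And>x. x \<in> S \<Longrightarrow> g x = (\<Sum>k\<in>A. v k * indicator (C k) x)"
  shows "step_function_on S g"
proof -
  obtain h where h: "bij_betw h {..<card A} A"
    using ex_bij_betw_nat_finite[OF assms(1)] by (auto simp: atLeast0LessThan)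
  have "step_representation S g (card A) (v \<circ> h) (C \<circ> h)"
    unfolding step_representation_def
  proof (intro conjI allI ballI impI)
    show "is_brick ((C \<circ> h) j)" "(C \<circ> h) j \<subseteq> S" if "j < card A" for j
      using assms(2)[OF bij_betw_apply[OF h]] that by simp_all
    show "g x = (\<Sum>j<card A. (v \<circ> h) j * indicator ((C \<circ> h) j) x)" if "x \<in> S" for x
      using sum.reindex_bij_betw[OF h, of "\<lambda>k. v k * indicator (C k) x"] assms(3)[OF that] by simp
  qed
  then show ?thesis
    unfolding step_function_on_def by blast
qed

lemma step_function_on_subbrick:
  assumes "step_function_on T g" "is_brick S" "S \<subseteq> T"
  shows "step_function_on S g"
proof -
  obtain M c B where B: "step_representation T g M c B"
    using assms unfolding step_function_on_def by blast
  \<comment> \<open>The empty set is not a brick, so pieces that miss \<open>S\<close> must be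
    dropped before intersecting.\<close>
  define J where "J = {j. j < M \<and> B j \<inter> S \<noteq> {}}"
  show ?thesis
  proof (rule step_function_onI)
    show "finite J" by (simp add: J_def)
    show "is_brick (B j \<inter> S) \<and> B j \<inter> S \<subseteq> S" if "j \<in> J" for j
      using that B is_brick_Int[OF _ assms(2), of "B j"] unfolding step_representation_def J_def by simp
    show "g x = (\<Sum>j\<in>J. c j * indicator (B j \<inter> S) x)" if "x \<in> S" for x
    proof -
      have "g x = (\<Sum>j<M. c j * indicator (B j) x)"
        using B subsetD[OF assms(3) that] unfolding step_representation_def by simp
      also have "\<dots> = (\<Sum>j\<in>J. c j * indicator (B j \<inter> S) x)"
        using that by (intro sum.mono_neutral_cong_right) (auto simp: J_def indicator_def)
      finally show ?thesis .
    qed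
  qed
qed

section \<open>Restricting covers and nearly uniform limits to subbricks\<close>

lemma restrict_brick_cover:
  assumes "finite \<B>" "\<And>B. B \<in> \<B> \<Longrightarrow> is_brick B" "is_brick S"
  obtains \<C> where "finite \<C>" "\<And>B. B \<in> \<C> \<Longrightarrow> is_brick B \<and> B \<subseteq> S"
    "(\<Sum>B\<in>\<C>. brick_volume B) \<le> (\<Sum>B\<in>\<B>. brick_volume B)" "\<Union>\<C> = S \<inter> \<Union>\<B>"
proof
  define \<D> where "\<D> = {B \<in> \<B>. B \<inter> S \<noteq> {}}"
  have fin: "finite \<D>" and brick: "\<And>B. B \<in> \<D> \<Longrightarrow> is_brick (B \<inter> S)"
    using assms by (auto simp: \<D>_def intro: is_brick_Int)
  show "finite ((\<lambda>B. B \<inter> S) ` \<D>)"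
    using fin by simp
  show "\<And>B. B \<in> (\<lambda>B. B \<inter> S) ` \<D> \<Longrightarrow> is_brick B \<and> B \<subseteq> S"
    using brick by blast
  \<comment> \<open>Different bricks may have the same trace on \<open>S\<close>, so passing to the
    image can lose terms; these are nonnegative.\<close>
  have "(\<Sum>B\<in>(\<lambda>B. B \<inter> S) ` \<D>. brick_volume B) \<le> (\<Sum>B\<in>\<D>. brick_volume (B \<inter> S))"
    using sum_image_le[OF fin, of brick_volume "\<lambda>B. B \<inter> S"] brick_volume_nonneg[OF brick]
    by (simp add: o_def)
  also have "\<dots> \<le> (\<Sum>B\<in>\<D>. brick_volume B)"
    using assms(2) brick by (intro sum_mono brick_volume_mono) (auto simp: \<D>_def)
  also have "\<dots> \<le> (\<Sum>B\<in>\<B>. brick_volume B)"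
    using assms(1,2) brick_volume_nonneg by (intro sum_mono2) (auto simp: \<D>_def)
  finally show "(\<Sum>B\<in>(\<lambda>B. B \<inter> S) ` \<D>. brick_volume B) \<le> (\<Sum>B\<in>\<B>. brick_volume B)" .
  show "\<Union>((\<lambda>B. B \<inter> S) ` \<D>) = S \<inter> \<Union>\<B>"
    by (auto simp: \<D>_def)
qed

lemma nearly_uniform_limitE:
  assumes "nearly_uniform_limit S F f" "\<delta> > 0"
  obtains \<B> where "finite \<B>" "\<And>B. B \<in> \<B> \<Longrightarrow> is_brick B" "\<And>B. B \<in> \<B> \<Longrightarrow> B \<subseteq> S"
    "(\<Sum>B\<in>\<B>. brick_volume B) < \<delta>" "uniform_limit (S - \<Union>\<B>) F f sequentially"
proof -
  from assms have "\<exists>\<B>. finite \<B> \<and> (\<forall>B\<in>\<B>. is_brick B \<and> B \<subseteq> S) \<and>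
      (\<Sum>B\<in>\<B>. brick_volume B) < \<delta> \<and> uniform_limit (S - \<Union>\<B>) F f sequentially"
    unfolding nearly_uniform_limit_def by simp
  then show thesis
    by (elim exE conjE) (rule that, simp_all)
qed

lemma nearly_uniform_limit_subbrick:
  assumes "nearly_uniform_limit T F f" "is_brick S" "S \<subseteq> T"
  shows "nearly_uniform_limit S F f"
  unfolding nearly_uniform_limit_def
proof (intro conjI allI impI)
  show "\<exists>K. \<forall>m. \<forall>x\<in>S. \<bar>F m x\<bar> \<le> K"
    using assms unfolding nearly_uniform_limit_def by blast
  fix \<delta> :: real assume "\<delta> > 0"
  then obtain \<B> where \<B>: "finite \<B>" "\<And>B. B \<in> \<B> \<Longrightarrow> is_brick B" "(\<Sum>B\<in>\<B>. brick_volume B) < \<delta>"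
      "uniform_limit (T - \<Union>\<B>) F f sequentially"
    by (rule nearly_uniform_limitE[OF assms(1)]) (rule that)
  obtain \<C> where \<C>: "finite \<C>" "\<And>B. B \<in> \<C> \<Longrightarrow> is_brick B \<and> B \<subseteq> S"
    "(\<Sum>B\<in>\<C>. brick_volume B) \<le> (\<Sum>B\<in>\<B>. brick_volume B)" "\<Union>\<C> = S \<inter> \<Union>\<B>"
    by (rule restrict_brick_cover[OF \<B>(1,2) assms(2)]) (assumption, rule that)
  have "uniform_limit (S - \<Union>\<C>) F f sequentially"
    using \<B>(4) by (rule uniform_limit_on_subset) (use \<C>(4) assms(3) in auto)
  then show "\<exists>\<B>. finite \<B> \<and> (\<forall>B\<in>\<B>. is_brick B \<and> B \<subseteq> S) \<and>
      (\<Sum>B\<in>\<B>. brick_volume B) < \<delta> \<and> uniform_limit (S - \<Union>\<B>) F f sequentially"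
    using \<C>(1,2,3) \<B>(3) by (intro exI[of _ \<C>]) auto
qed

lemma K_integrable_onE:
  assumes "f K_integrable_on S"
  obtains g where "\<And>m. step_function_on S (g m)" "nearly_uniform_limit S g f"
  using assms unfolding K_integrable_on_def by (elim exE conjE) (rule that, erule spec)

lemma K_integrable_onI:
  "(\<And>m. step_function_on S (g m)) \<Longrightarrow> nearly_uniform_limit S g f \<Longrightarrow> f K_integrable_on S"
  unfolding K_integrable_on_def by (intro exI[of _ g]) simp

lemma K_integrable_on_subbrick:
  assumes "f K_integrable_on T" "is_brick S" "S \<subseteq> T"
  shows "f K_integrable_on S"
proof (rule K_integrable_onE[OF assms(1)])
  fix g assume "\<And>m. step_function_on T (g m)" "nearly_uniform_limit T g f"
  then show ?thesis
    by (intro K_integrable_onI step_function_on_subbrick[OF _ assms(2,3)]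
          nearly_uniform_limit_subbrick[OF _ assms(2,3)])
qed

section \<open>Passing to the limit under the integral\<close>

text \<open>For every \<delta> the points without convergence lie in finitely many bricks of total
  volume below \<delta>, so they form a set of outer measure zero.\<close>

lemma nearly_uniform_limit_pointwise:
  assumes "nearly_uniform_limit S F f"
  obtains Z where "negligible Z" "\<And>x. x \<in> S - Z \<Longrightarrow> (\<lambda>m. F m x) \<longlonglongrightarrow> f x"
proof
  show "negligible {x \<in> S. \<not> (\<lambda>m. F m x) \<longlonglongrightarrow> f x}" (is "negligible ?Z")
    unfolding negligible_outer
  proof (intro allI impI)
    fix \<delta> :: real assume "\<delta> > 0"
    then obtain \<B> where \<B>: "finite \<B>" "\<And>B. B \<in> \<B> \<Longrightarrow> is_brick B" "(\<Sum>B\<in>\<B>. brick_volume B) < \<delta>"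
        "uniform_limit (S - \<Union>\<B>) F f sequentially"
      by (rule nearly_uniform_limitE[OF assms]) (rule that)
    have "?Z \<subseteq> \<Union>\<B>"
      using tendsto_uniform_limitI[OF \<B>(4)] by blast
    then show "\<exists>T. ?Z \<subseteq> T \<and> T \<in> lmeasurable \<and> measure lebesgue T < \<delta>"
      using \<B>(3) measure_Union_bricks_le[OF \<B>(1,2)] lmeasurable_Union_bricks[OF \<B>(1,2)]
      by (intro exI[of _ "\<Union>\<B>"]) simp
  qed
qed simp

lemma
  assumes "is_brick S" "\<And>m. step_function_on S (g m)" "nearly_uniform_limit S g f"
  shows nearly_uniform_limit_integrable: "f integrable_on S"
    and step_integral_tendsto: "(\<lambda>m. step_integral S (g m)) \<longlonglongrightarrow> integral S f"
proof -
  obtain K where K: "\<And>m x. x \<in> S \<Longrightarrow> \<bar>g m x\<bar> \<le> K"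
    using assms(3) unfolding nearly_uniform_limit_def by blast
  obtain Z where Z: "negligible Z" "\<And>x. x \<in> S - Z \<Longrightarrow> (\<lambda>m. g m x) \<longlonglongrightarrow> f x"
    using nearly_uniform_limit_pointwise[OF assms(3)] by blast
  \<comment> \<open>Setting the functions to zero on \<open>Z\<close> turns convergence almost
    everywhere into convergence at every point, as dominated convergence requires, and leaves all
    integrals unchanged.\<close>
  define g' where "g' = (\<lambda>m x. if x \<in> Z then 0 else g m x)"
  define f' where "f' = (\<lambda>x. if x \<in> Z then 0 else f x)"
  have g'_eq: "\<And>m x. x \<in> S - Z \<Longrightarrow> g' m x = g m x" and f'_eq: "\<And>x. x \<in> S - Z \<Longrightarrow> f x = f' x"
    by (auto simp: g'_def f'_def)
  have g: "(g m has_integral step_integral S (g m)) S" for m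
    by (rule step_function_has_integral[OF assms(2)])
  have g': "(g' m has_integral step_integral S (g m)) S" for m
    by (rule has_integral_spike[OF Z(1) g'_eq g])
  have "(indicator S :: _ \<Rightarrow> real) integrable_on S"
    using indicator_brick_has_integral[OF assms(1) order_refl] by blast
  \<comment> \<open>\<open>max K 0\<close> also dominates the value zero taken on \<open>Z\<close>.
    The constant is written with the indicator because \<open>S\<close> may be a brick of any kind,
    whose integrability is known in that form.\<close>
  then have const: "(\<lambda>x. max K 0 * indicator S x) integrable_on S"
    by (rule integrable_on_mult_right)
  have le: "norm (g' m x) \<le> max K 0 * indicator S x" if "x \<in> S" for m x
    using K[OF that, of m] that by (cases "x \<in> Z") (simp_all add: g'_def max.coboundedI1)
  have lim: "(\<lambda>m. g' m x) \<longlonglongrightarrow> f' x" if "x \<in> S" for x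
    using Z(2)[of x] that by (cases "x \<in> Z") (simp_all add: g'_def f'_def)
  note dc = dominated_convergence[OF has_integral_integrable[OF g'] const le lim]
  have "integral S (g' m) = step_integral S (g m)" for m
    by (rule integral_unique[OF g'])
  moreover have "integral S f' = integral S f"
    by (rule integral_spike[OF Z(1) f'_eq])
  ultimately show "(\<lambda>m. step_integral S (g m)) \<longlonglongrightarrow> integral S f"
    using dc(2) by simp
  show "f integrable_on S"
    by (rule integrable_spike[OF dc(1) Z(1) f'_eq])
qed

lemma K_integrable_imp_integrable:
  assumes "is_brick S" "f K_integrable_on S"
  shows "f integrable_on S"
  by (rule K_integrable_onE[OF assms(2)]) (rule nearly_uniform_limit_integrable[OF assms(1)])

text \<open>For every approximating sequence the step integrals tend to the same Henstock-Kurzweil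
  integral. This gives both existence and uniqueness for the definite description in
  \<open>K_integral\<close>.\<close>

lemma K_integral_eq_integral:
  assumes "is_brick S" "f K_integrable_on S"
  shows "K_integral S f = integral S f"
  unfolding K_integral_def
proof (rule the_equality)
  obtain g where g: "\<And>m. step_function_on S (g m)" "nearly_uniform_limit S g f"
    by (rule K_integrable_onE[OF assms(2)]) (rule that)
  then show "\<exists>g. (\<forall>m. step_function_on S (g m)) \<and> nearly_uniform_limit S g f \<and>
      (\<lambda>m. step_integral S (g m)) \<longlonglongrightarrow> integral S f"
    using step_integral_tendsto[OF assms(1) g] by (intro exI[of _ g]) simp
  fix I assume "\<exists>g. (\<forall>m. step_function_on S (g m)) \<and> nearly_uniform_limit S g f \<and>
      (\<lambda>m. step_integral S (g m)) \<longlonglongrightarrow> I"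
  then show "I = integral S f"
    by (elim exE conjE) (rule LIMSEQ_unique, assumption, simp add: step_integral_tendsto[OF assms(1)])
qed

section \<open>Jordan null sets\<close>

text \<open>The volume of the surrounding box, widened by \<open>r\<close> on every side, depends
  continuously on \<open>r\<close>, so some positive \<open>r\<close> adds less than
  \<open>e\<close>.\<close>

lemma brick_open_enlargement:
  fixes B :: "(real ^ 'n) set"
  assumes "is_brick B" "e > 0"
  obtains D where "is_brick D" "open D" "closure B \<subseteq> D" "brick_volume D < brick_volume B + e"
proof -
  obtain l h where lh: "\<And>i. l $ i \<le> h $ i" "box l h \<subseteq> B" "B \<subseteq> cbox l h"
    "brick_volume B = (\<Prod>i\<in>UNIV. h $ i - l $ i)"
    by (rule brick_sandwich[OF assms(1)]) (rule that)
  have "((\<lambda>r::real. \<Prod>i\<in>UNIV. h $ i - l $ i + 2 * r) \<longlongrightarrow> (\<Prod>i\<in>UNIV. h $ i - l $ i + 2 * 0)) (at_right 0)"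
    by (intro tendsto_intros)
  then have "\<forall>\<^sub>F r in at_right 0. (\<Prod>i\<in>UNIV. h $ i - l $ i + 2 * r) < brick_volume B + e"
    using assms(2) lh(4) by (intro order_tendstoD(2)) auto
  then obtain r :: real where r: "r > 0" "(\<Prod>i\<in>UNIV. h $ i - l $ i + 2 * r) < brick_volume B + e"
    using eventually_happens'[OF trivial_limit_at_right_real eventually_conj[OF eventually_at_right_less]]
    by blast
  define p q where "p = (\<chi> i. l $ i - r)" and "q = (\<chi> i. h $ i + r)"
  have less: "p $ i < q $ i" for i
    using lh(1)[of i] r(1) by (simp add: p_def q_def)
  have brick: "is_brick (box p q)"
    using is_brickI[of "\<lambda>i. {p $ i<..<q $ i}"] less
    by (simp add: interval_cart is_interval_oo not_le)
  have ne: "cbox p q \<noteq> {}"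
    using less by (simp add: interval_ne_empty_cart less_imp_le)
  have "measure lborel (box p q) = measure lborel (cbox p q)"
    by (simp add: measure_lborel_box_eq measure_lborel_cbox_eq)
  then have "brick_volume (box p q) = (\<Prod>i\<in>UNIV. q $ i - p $ i)"
    using measure_brick[OF brick] by (simp add: content_cbox_cart[OF ne])
  also have "\<dots> = (\<Prod>i\<in>UNIV. h $ i - l $ i + 2 * r)"
    by (simp add: p_def q_def algebra_simps)
  finally have vol: "brick_volume (box p q) < brick_volume B + e"
    using r(2) by simp
  have "cbox l h \<subseteq> box p q"
  proof
    fix x assume x: "x \<in> cbox l h"
    have "p $ i < x $ i \<and> x $ i < q $ i" for i
    proof -
      have "l $ i \<le> x $ i" "x $ i \<le> h $ i"
        using x by (simp_all add: mem_box_cart)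
      then show ?thesis
        using r(1) by (simp add: p_def q_def)
    qed
    then show "x \<in> box p q"
      by (simp add: mem_box_cart)
  qed
  then have "closure B \<subseteq> box p q"
    using closure_minimal[OF lh(3) closed_cbox] by blast
  then show thesis
    using that[OF brick open_box _ vol] by blast
qed

text \<open>Since the union is finite, its closure is covered by the closures of the bricks, and
  each of these fits into a slightly larger open brick. Outside the new cover, points are then
  bounded away from the old bricks on compact sets.\<close>

lemma open_brick_cover:
  fixes \<B> :: "(real ^ 'n) set set"
  assumes "finite \<B>" "\<And>B. B \<in> \<B> \<Longrightarrow> is_brick B" "(\<Sum>B\<in>\<B>. brick_volume B) < \<delta>"
  obtains \<D> where "finite \<D>" "\<And>D. D \<in> \<D> \<Longrightarrow> is_brick D" "open (\<Union>\<D>)" "closure (\<Union>\<B>) \<subseteq> \<Union>\<D>"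
    "(\<Sum>D\<in>\<D>. brick_volume D) < \<delta>"
proof -
  \<comment> \<open>Less than half of the slack below \<delta> is distributed among the bricks; the
    \<open>+ 1\<close> keeps the denominator positive when \<B> is empty.\<close>
  define e where "e = (\<delta> - (\<Sum>B\<in>\<B>. brick_volume B)) / (2 * (card \<B> + 1))"
  have e: "e > 0"
    using assms(3) by (simp add: e_def)
  have "\<forall>B\<in>\<B>. \<exists>D. is_brick D \<and> open D \<and> closure B \<subseteq> D \<and> brick_volume D < brick_volume B + e"
  proof
    fix B assume "B \<in> \<B>"
    then show "\<exists>D. is_brick D \<and> open D \<and> closure B \<subseteq> D \<and> brick_volume D < brick_volume B + e"
      by (rule brick_open_enlargement[OF assms(2) e]) blast
  qed
  then have "\<exists>E. \<forall>B\<in>\<B>. is_brick (E B) \<and> open (E B) \<and> closure B \<subseteq> E B \<and> brick_volume (E B) < brick_volume B + e"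
    by (rule bchoice)
  then obtain E where "\<forall>B\<in>\<B>. is_brick (E B) \<and> open (E B) \<and> closure B \<subseteq> E B \<and> brick_volume (E B) < brick_volume B + e"
    ..
  then have E: "\<And>B. B \<in> \<B> \<Longrightarrow> is_brick (E B)" "\<And>B. B \<in> \<B> \<Longrightarrow> open (E B)"
    "\<And>B. B \<in> \<B> \<Longrightarrow> closure B \<subseteq> E B" "\<And>B. B \<in> \<B> \<Longrightarrow> brick_volume (E B) < brick_volume B + e"
    by simp_all
  have "(\<Sum>D\<in>E ` \<B>. brick_volume D) \<le> (\<Sum>B\<in>\<B>. brick_volume (E B))"
    using sum_image_le[OF assms(1), of brick_volume E] brick_volume_nonneg[OF E(1)]
    by (simp add: o_def)
  also have "\<dots> \<le> (\<Sum>B\<in>\<B>. brick_volume B + e)"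
    by (intro sum_mono less_imp_le E(4))
  also have "\<dots> = (\<Sum>B\<in>\<B>. brick_volume B) + card \<B> * e"
    by (simp add: sum.distrib)
  also have "\<dots> < (\<Sum>B\<in>\<B>. brick_volume B) + 2 * (card \<B> + 1) * e"
    using e by (simp add: algebra_simps add_nonneg_pos)
  also have "\<dots> = \<delta>"
    by (simp add: e_def del: of_nat_add)
  finally have "(\<Sum>D\<in>E ` \<B>. brick_volume D) < \<delta>" .
  moreover have "closure (\<Union>\<B>) \<subseteq> \<Union>(E ` \<B>)"
  proof -
    have "closure (\<Union>\<B>) \<subseteq> \<Union>(closure ` \<B>)"
      using assms(1) by (intro closure_minimal) (auto simp: closure_subset[THEN subsetD])
    then show ?thesis
      using E(3) by blast
  qed
  ultimately show thesis
    using that[of "E ` \<B>"] assms(1) E(1,2) by auto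
qed

lemma jordan_nullE:
  assumes "jordan_null A" "\<epsilon> > 0"
  obtains \<B> where "finite \<B>" "\<And>B. B \<in> \<B> \<Longrightarrow> is_brick B" "A \<subseteq> \<Union>\<B>"
    "(\<Sum>B\<in>\<B>. brick_volume B) < \<epsilon>"
proof -
  from assms have "\<exists>\<B>. finite \<B> \<and> (\<forall>B\<in>\<B>. is_brick B) \<and> A \<subseteq> \<Union>\<B> \<and> (\<Sum>B\<in>\<B>. brick_volume B) < \<epsilon>"
    unfolding jordan_null_def by simp
  then show thesis
    by (elim exE conjE) (rule that, simp_all)
qed

lemma jordan_nullI:
  assumes "\<And>\<epsilon>. \<epsilon> > 0 \<Longrightarrow> \<exists>\<B>. finite \<B> \<and> (\<forall>B\<in>\<B>. is_brick B) \<and> A \<subseteq> \<Union>\<B> \<and> (\<Sum>B\<in>\<B>. brick_volume B) < \<epsilon>"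
  shows "jordan_null A"
  using assms unfolding jordan_null_def by simp

lemma jordan_null_subset: "jordan_null B \<Longrightarrow> A \<subseteq> B \<Longrightarrow> jordan_null A"
  unfolding jordan_null_def by (meson order_trans)

lemma jordan_null_Un:
  assumes "jordan_null A" "jordan_null B"
  shows "jordan_null (A \<union> B)"
proof (rule jordan_nullI)
  fix \<epsilon> :: real assume "\<epsilon> > 0"
  then have \<epsilon>: "\<epsilon> / 2 > 0" by simp
  obtain \<A> where \<A>: "finite \<A>" "\<And>B. B \<in> \<A> \<Longrightarrow> is_brick B" "A \<subseteq> \<Union>\<A>" "(\<Sum>B\<in>\<A>. brick_volume B) < \<epsilon> / 2"
    by (rule jordan_nullE[OF assms(1) \<epsilon>]) (rule that)
  obtain \<B> where \<B>: "finite \<B>" "\<And>B. B \<in> \<B> \<Longrightarrow> is_brick B" "B \<subseteq> \<Union>\<B>" "(\<Sum>B\<in>\<B>. brick_volume B) < \<epsilon> / 2"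
    by (rule jordan_nullE[OF assms(2) \<epsilon>]) (rule that)
  have "(\<Sum>B\<in>\<A> \<union> \<B>. brick_volume B) \<le> (\<Sum>B\<in>\<A>. brick_volume B) + (\<Sum>B\<in>\<B>. brick_volume B)"
    by (subst sum.union_inter[OF \<A>(1) \<B>(1), symmetric])
       (use \<A>(2) in \<open>auto intro!: sum_nonneg brick_volume_nonneg\<close>)
  then have "(\<Sum>B\<in>\<A> \<union> \<B>. brick_volume B) < \<epsilon>"
    using \<A>(4) \<B>(4) by simp
  then show "\<exists>\<C>. finite \<C> \<and> (\<forall>B\<in>\<C>. is_brick B) \<and> A \<union> B \<subseteq> \<Union>\<C> \<and> (\<Sum>B\<in>\<C>. brick_volume B) < \<epsilon>"
    using \<A>(1,2,3) \<B>(1,2,3) by (intro exI[of _ "\<A> \<union> \<B>"]) auto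
qed

lemma jordan_null_imp_negligible:
  assumes "jordan_null A"
  shows "negligible A"
  unfolding negligible_outer
proof (intro allI impI)
  fix \<epsilon> :: real assume "\<epsilon> > 0"
  then obtain \<B> where \<B>: "finite \<B>" "\<And>B. B \<in> \<B> \<Longrightarrow> is_brick B" "A \<subseteq> \<Union>\<B>" "(\<Sum>B\<in>\<B>. brick_volume B) < \<epsilon>"
    by (rule jordan_nullE[OF assms(1)]) (rule that)
  show "\<exists>T. A \<subseteq> T \<and> T \<in> lmeasurable \<and> measure lebesgue T < \<epsilon>"
    using \<B>(3,4) measure_Union_bricks_le[OF \<B>(1,2)] lmeasurable_Union_bricks[OF \<B>(1,2)]
    by (intro exI[of _ "\<Union>\<B>"]) simp
qed

text \<open>Differentiability is declared only at interior points, so the boundary is always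
  exceptional. It is covered by the lower and upper face in each coordinate, which are degenerate
  bricks of volume zero.\<close>

lemma jordan_null_cbox_diff_box:
  fixes a b :: "real ^ 'n"
  assumes "\<And>i. a $ i \<le> b $ i"
  shows "jordan_null (cbox a b - box a b)"
proof (rule jordan_nullI)
  fix \<epsilon> :: real assume "\<epsilon> > 0"
  define lo up where "lo = (\<lambda>k. {x. \<forall>i. x $ i \<in> (if i = k then {a $ i} else {a $ i..b $ i})})"
    and "up = (\<lambda>k. {x. \<forall>i. x $ i \<in> (if i = k then {b $ i} else {a $ i..b $ i})})"
  have brick: "is_brick (lo k)" "is_brick (up k)" for k
    unfolding lo_def up_def
    by (intro is_brickI; use assms in \<open>simp add: is_interval_cc is_interval_1\<close>)+
  have "negligible {x :: real ^ 'n. x $ k = c}" for k c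
    using negligible_standard_hyperplane[of "axis k (1 :: real)" c] by (simp add: inner_axis axis_in_Basis_iff inner_real_def)
  then have "negligible (lo k)" "negligible (up k)" for k
    by (auto simp: lo_def up_def intro: negligible_subset dest: spec[of _ k])
  then have "brick_volume (lo k) = 0" "brick_volume (up k) = 0" for k
    using measure_brick[OF brick(1)] measure_brick[OF brick(2)] by (simp_all add: negligible_imp_measure0)
  then have "(\<Sum>B\<in>range lo \<union> range up. brick_volume B) = 0"
    by (intro sum.neutral) auto
  moreover have "cbox a b - box a b \<subseteq> \<Union>(range lo \<union> range up)"
  proof
    fix x assume x: "x \<in> cbox a b - box a b"
    then obtain k where "x $ k = a $ k \<or> x $ k = b $ k"
      by (auto simp: mem_box_cart not_less intro: antisym)
    then have "x \<in> lo k \<or> x \<in> up k"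
      using x by (auto simp: lo_def up_def mem_box_cart)
    then show "x \<in> \<Union>(range lo \<union> range up)" by blast
  qed
  ultimately show "\<exists>\<B>. finite \<B> \<and> (\<forall>B\<in>\<B>. is_brick B) \<and> cbox a b - box a b \<subseteq> \<Union>\<B> \<and>
      (\<Sum>B\<in>\<B>. brick_volume B) < \<epsilon>"
    using brick \<open>\<epsilon> > 0\<close> by (intro exI[of _ "range lo \<union> range up"]) auto
qed

section \<open>Local behaviour of step functions\<close>

text \<open>A Cauchy criterion: each \<open>A d\<close> serves as the stage at scale
  \<open>d\<close>, and the approximating constant may change with \<open>e\<close>. Two values near
  the same constant are near each other, so completeness of the reals yields a limit not known
  beforehand.\<close>

lemma near_constant_imp_limit:
  fixes q :: "'a \<Rightarrow> real" and A :: "real \<Rightarrow> 'a set"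
  assumes mono: "\<And>d d'. d \<le> d' \<Longrightarrow> A d \<subseteq> A d'"
    and near: "\<And>e. e > 0 \<Longrightarrow> \<exists>c. \<exists>d>0. \<forall>S\<in>A d. \<bar>q S - c\<bar> \<le> e"
  shows "\<exists>t. \<forall>e>0. \<exists>d>0. \<forall>S\<in>A d. \<bar>q S - t\<bar> < e"
proof (cases "\<exists>d>0. A d = {}")
  \<comment> \<open>If some stage is empty, every \<open>t\<close> satisfies the condition
    vacuously.\<close>
  case True
  then show ?thesis by blast
next
  case False
  \<comment> \<open>One sample from each stage of a shrinking sequence; the limit of
    \<open>q\<close> along these samples is the candidate for \<open>t\<close>.\<close>
  define S where "S = (\<lambda>n. SOME S. S \<in> A (inverse (real (Suc n))))"
  have "A (inverse (real (Suc n))) \<noteq> {}" for n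
    using False by simp
  then have S: "S n \<in> A (inverse (real (Suc n)))" for n
    unfolding S_def by (simp add: some_in_eq)
  have ev: "\<exists>N. \<forall>n\<ge>N. S n \<in> A d" if d: "d > 0" for d
  proof -
    obtain N where N: "inverse (real (Suc N)) < d"
      using reals_Archimedean[OF d] by blast
    have "S n \<in> A d" if "n \<ge> N" for n
    proof -
      have "inverse (real (Suc n)) \<le> d"
        using that by (intro order_trans[OF _ less_imp_le[OF N]] le_imp_inverse_le) simp_all
      then show ?thesis
        using S[of n] mono by blast
    qed
    then show ?thesis by blast
  qed
  have "Cauchy (\<lambda>n. q (S n))"
  proof (rule metric_CauchyI)
    fix e :: real assume "e > 0"
    then have e: "e / 3 > 0" by simp
    obtain c d where d: "d > 0" "\<And>S. S \<in> A d \<Longrightarrow> \<bar>q S - c\<bar> \<le> e / 3"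
      using near[OF e] by blast
    obtain N where N: "\<And>n. n \<ge> N \<Longrightarrow> S n \<in> A d"
      using ev[OF d(1)] by blast
    have "dist (q (S m)) (q (S n)) < e" if "m \<ge> N" "n \<ge> N" for m n
      using d(2)[OF N[OF that(1)]] d(2)[OF N[OF that(2)]] \<open>e > 0\<close> unfolding dist_real_def by linarith
    then show "\<exists>N. \<forall>m\<ge>N. \<forall>n\<ge>N. dist (q (S m)) (q (S n)) < e"
      by blast
  qed
  then obtain t where t: "(\<lambda>n. q (S n)) \<longlonglongrightarrow> t"
    using Cauchy_convergent_iff convergentD by blast
  have "\<exists>d>0. \<forall>S\<in>A d. \<bar>q S - t\<bar> < e" if "e > 0" for e
  proof -
    have e: "e / 3 > 0" using that by simp
    obtain c d where d: "d > 0" "\<And>S. S \<in> A d \<Longrightarrow> \<bar>q S - c\<bar> \<le> e / 3"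
      using near[OF e] by blast
    obtain N where N: "\<And>n. n \<ge> N \<Longrightarrow> S n \<in> A d"
      using ev[OF d(1)] by blast
    obtain n where n: "n \<ge> N" "\<bar>q (S n) - t\<bar> < e / 3"
      using LIMSEQ_D[OF t e] by (metis max.cobounded1 max.cobounded2 real_norm_def)
    have "\<bar>q X - t\<bar> < e" if "X \<in> A d" for X
      using d(2)[OF that] d(2)[OF N[OF n(1)]] n(2) by linarith
    then show ?thesis
      using d(1) by blast
  qed
  then show ?thesis by blast
qed

lemma closed_subbricksE:
  assumes "S \<in> closed_subbricks a b"
  obtains \<alpha> \<beta> where "S = cbox \<alpha> \<beta>" "cbox \<alpha> \<beta> \<noteq> {}" "S \<subseteq> cbox a b"
  using assms unfolding closed_subbricks_iff by blast

text \<open>The bound is assumed only on the interior because a step function is constant near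
  \<open>u\<close> only on an open side of the coordinate hyperplanes. The boundary of the box is
  negligible, so \<open>h\<close> may be set to zero there.\<close>

lemma integral_deviation_le:
  fixes f :: "real ^ 'n \<Rightarrow> real"
  assumes "S \<in> closed_subbricks a b" "f integrable_on S" "e \<ge> 0"
    and "\<And>x. x \<in> interior S \<Longrightarrow> \<bar>f x - c\<bar> \<le> e"
  shows "\<bar>integral S f - c * brick_volume S\<bar> \<le> e * brick_volume S"
proof -
  obtain \<alpha> \<beta> where S: "S = cbox \<alpha> \<beta>" "cbox \<alpha> \<beta> \<noteq> {}" "S \<subseteq> cbox a b"
    by (rule closed_subbricksE[OF assms(1)]) (rule that)
  define h where "h = (\<lambda>x. if x \<in> box \<alpha> \<beta> then f x - c else 0)"
  have "((\<lambda>x. f x - c) has_integral (integral S f - c * brick_volume S)) S"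
  proof (intro has_integral_diff integrable_integral assms(2))
    show "((\<lambda>x. c) has_integral c * brick_volume S) S"
      using has_integral_const[of c \<alpha> \<beta>] closed_subbricks_content[OF assms(1)]
      by (simp add: S(1) mult.commute)
  qed
  then have "(h has_integral (integral S f - c * brick_volume S)) S"
    by (rule has_integral_spike[OF negligible_frontier_interval[of \<alpha> \<beta>], rotated])
       (simp add: h_def S(1))
  then have "norm (integral S f - c * brick_volume S) \<le> e * measure lborel (cbox \<alpha> \<beta>)"
    unfolding S(1)
    by (rule has_integral_bound[OF assms(3)]) (use assms(3,4) S(1) in \<open>simp add: h_def\<close>)
  then show ?thesis
    using closed_subbricks_content[OF assms(1)] by (simp add: S(1))
qed

section \<open>One-sided constancy of indicators and step functions\<close>

text \<open>Either \<open>I\<close> misses some right neighbourhood of \<open>v\<close>, or it has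
  points arbitrarily close to \<open>v\<close> on the right; in the latter case convexity fills the
  gap up to a fixed such point \<open>p\<close>.\<close>

lemma interval_eventually_at_right:
  fixes I :: "real set"
  assumes "is_interval I"
  shows "\<exists>P. \<forall>\<^sub>F y in at_right v. (y \<in> I) = P"
proof (cases "\<exists>b>v. \<forall>y. v < y \<and> y < b \<longrightarrow> y \<notin> I")
  case True
  then show ?thesis
    unfolding eventually_at_right_field by (intro exI[of _ False]) blast
next
  case False
  then have F: "\<And>b. b > v \<Longrightarrow> \<exists>y. v < y \<and> y < b \<and> y \<in> I" by blast
  obtain p where p: "p \<in> I" "v < p"
    using F[of "v + 1"] by auto
  have "y \<in> I" if y: "v < y" "y < p" for y
  proof -
    obtain z where z: "v < z" "z < y" "z \<in> I"
      using F[OF y(1)] by blast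
    show ?thesis
      using assms[unfolded is_interval_1, rule_format, OF z(3) p(1)] z(2) y(2) by simp
  qed
  then show ?thesis
    unfolding eventually_at_right_field using p(2) by (intro exI[of _ True]) blast
qed

text \<open>Reflection at the origin carries left neighbourhoods to right ones and intervals to
  intervals.\<close>

lemma interval_eventually_at_left:
  fixes I :: "real set"
  assumes "is_interval I"
  shows "\<exists>P. \<forall>\<^sub>F y in at_left v. (y \<in> I) = P"
proof -
  have "is_interval (uminus ` I)"
    using assms by simp
  then obtain P where "\<forall>\<^sub>F y in at_right (- v). (y \<in> uminus ` I) = P"
    using interval_eventually_at_right by blast
  then have "\<forall>\<^sub>F y in at_left v. (- y \<in> uminus ` I) = P"
    by (simp add: at_right_minus eventually_filtermap)
  moreover have "- y \<in> uminus ` I \<longleftrightarrow> y \<in> I" for y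
    by auto
  ultimately show ?thesis by auto
qed

text \<open>In the quadrant each coordinate stays strictly on one side of \<open>u $ k\<close>, so
  membership in each factor of \<open>B\<close> is eventually decided by the one-sided statements,
  and there are finitely many factors.\<close>

lemma brick_eventually_in_quadrant:
  fixes B :: "(real ^ 'n) set"
  assumes "is_brick B"
  shows "\<exists>c. \<forall>\<^sub>F x in nhds u. x \<in> quadrant a b u \<alpha> \<longrightarrow> indicat_real B x = c"
proof -
  obtain I where I: "\<And>i. is_interval (I i)" "B = {x. \<forall>i. x $ i \<in> I i}"
    by (rule is_brickE[OF assms]) (rule that)
  have "\<exists>P. \<forall>\<^sub>F x in nhds u. x \<in> quadrant a b u \<alpha> \<longrightarrow> (x $ k \<in> I k) = P" for k
  proof -
    let ?J = "if \<alpha> $ k = -1 then {a $ k ..< u $ k} else {u $ k <.. b $ k}"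
    have "\<exists>P. \<forall>\<^sub>F y in nhds (u $ k). y \<in> ?J \<longrightarrow> (y \<in> I k) = P"
    proof (cases "\<alpha> $ k = -1")
      case True
      then show ?thesis
        using interval_eventually_at_left[OF I(1)[of k], of "u $ k"]
        by (auto simp: eventually_at_filter elim!: eventually_mono)
    next
      case False
      then show ?thesis
        using interval_eventually_at_right[OF I(1)[of k], of "u $ k"]
        by (auto simp: eventually_at_filter elim!: eventually_mono)
    qed
    then obtain P where P: "\<forall>\<^sub>F y in nhds (u $ k). y \<in> ?J \<longrightarrow> (y \<in> I k) = P" ..
    have "filterlim (\<lambda>x. x $ k) (nhds (u $ k)) (nhds u)"
      by (intro tendsto_vec_nth filterlim_ident)
    then have "\<forall>\<^sub>F x in nhds u. x $ k \<in> ?J \<longrightarrow> (x $ k \<in> I k) = P"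
      using P by (rule eventually_compose_filterlim[rotated])
    then have "\<forall>\<^sub>F x in nhds u. x \<in> quadrant a b u \<alpha> \<longrightarrow> (x $ k \<in> I k) = P"
      by (rule eventually_mono) (auto simp: quadrant_def)
    then show ?thesis ..
  qed
  then have "\<forall>k. \<exists>P. \<forall>\<^sub>F x in nhds u. x \<in> quadrant a b u \<alpha> \<longrightarrow> (x $ k \<in> I k) = P" ..
  then obtain P where "\<forall>k. \<forall>\<^sub>F x in nhds u. x \<in> quadrant a b u \<alpha> \<longrightarrow> (x $ k \<in> I k) = P k"
    unfolding choice_iff ..
  then have "\<forall>\<^sub>F x in nhds u. \<forall>k. x \<in> quadrant a b u \<alpha> \<longrightarrow> (x $ k \<in> I k) = P k"
    by (intro eventually_all_finite) simp
  then have "\<forall>\<^sub>F x in nhds u. x \<in> quadrant a b u \<alpha> \<longrightarrow> indicat_real B x = of_bool (\<forall>k. P k)"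
    by (rule eventually_mono) (auto simp: I(2) indicator_def)
  then show ?thesis ..
qed

lemma brick_eventually_off_frontier:
  assumes "u \<notin> frontier B"
  shows "\<exists>c. \<forall>\<^sub>F x in nhds u. indicat_real B x = c"
proof (cases "u \<in> interior B")
  case True
  then have "\<forall>\<^sub>F x in nhds u. x \<in> interior B"
    by (intro eventually_nhds_in_open) auto
  then have "\<forall>\<^sub>F x in nhds u. indicat_real B x = 1"
    by (rule eventually_mono) (simp add: indicator_def interior_subset[THEN subsetD])
  then show ?thesis ..
next
  case False
  then have "\<forall>\<^sub>F x in nhds u. x \<in> - closure B"
    using assms by (intro eventually_nhds_in_open) (auto simp: frontier_def)
  then have "\<forall>\<^sub>F x in nhds u. indicat_real B x = 0"
    by (rule eventually_mono) (use closure_subset in \<open>auto simp: indicator_def\<close>)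
  then show ?thesis ..
qed

text \<open>The set \<open>W\<close> will be the whole space for the full derivative and a quadrant
  for a directional one, so both cases share one argument.\<close>

lemma step_representation_eventually_constant:
  assumes "step_representation T g M c B"
    and "\<And>j. j < M \<Longrightarrow> \<exists>p. \<forall>\<^sub>F x in nhds u. x \<in> W \<longrightarrow> indicat_real (B j) x = p"
  shows "\<exists>p. \<forall>\<^sub>F x in nhds u. x \<in> W \<inter> T \<longrightarrow> g x = p"
proof -
  have "\<forall>j\<in>{..<M}. \<exists>p. \<forall>\<^sub>F x in nhds u. x \<in> W \<longrightarrow> indicat_real (B j) x = p"
    using assms(2) by simp
  then have "\<exists>p. \<forall>j\<in>{..<M}. \<forall>\<^sub>F x in nhds u. x \<in> W \<longrightarrow> indicat_real (B j) x = p j"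
    by (rule bchoice)
  then obtain p where "\<forall>j\<in>{..<M}. \<forall>\<^sub>F x in nhds u. x \<in> W \<longrightarrow> indicat_real (B j) x = p j" ..
  then have "\<forall>\<^sub>F x in nhds u. \<forall>j\<in>{..<M}. x \<in> W \<longrightarrow> indicat_real (B j) x = p j"
    by (intro eventually_ball_finite) simp_all
  then have "\<forall>\<^sub>F x in nhds u. x \<in> W \<inter> T \<longrightarrow> g x = (\<Sum>j<M. c j * p j)"
  proof (rule eventually_mono, intro impI)
    fix x assume x: "\<forall>j\<in>{..<M}. x \<in> W \<longrightarrow> indicat_real (B j) x = p j" "x \<in> W \<inter> T"
    then have "g x = (\<Sum>j<M. c j * indicat_real (B j) x)"
      using assms(1) unfolding step_representation_def by blast
    also have "\<dots> = (\<Sum>j<M. c j * p j)"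
      using x by (intro sum.cong) auto
    finally show "g x = (\<Sum>j<M. c j * p j)" .
  qed
  then show ?thesis ..
qed

section \<open>Indefinite integrals\<close>

text \<open>Convergence is uniform on the open complement of the closure of the exceptional bricks.
  That closure is covered by open bricks whose total volume is still below \<epsilon>.\<close>

lemma nearly_uniform_limit_locally_uniform:
  assumes "nearly_uniform_limit S F f"
  shows "jordan_null {u \<in> S. \<not> (\<exists>U. open U \<and> u \<in> U \<and> uniform_limit (U \<inter> S) F f sequentially)}"
proof (rule jordan_nullI)
  fix \<epsilon> :: real assume \<epsilon>: "\<epsilon> > 0"
  obtain \<B> where \<B>: "finite \<B>" "\<And>B. B \<in> \<B> \<Longrightarrow> is_brick B" "(\<Sum>B\<in>\<B>. brick_volume B) < \<epsilon>"
      "uniform_limit (S - \<Union>\<B>) F f sequentially"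
    by (rule nearly_uniform_limitE[OF assms \<epsilon>]) (rule that)
  obtain \<D> where \<D>: "finite \<D>" "\<And>D. D \<in> \<D> \<Longrightarrow> is_brick D" "closure (\<Union>\<B>) \<subseteq> \<Union>\<D>"
    "(\<Sum>D\<in>\<D>. brick_volume D) < \<epsilon>"
    by (rule open_brick_cover[OF \<B>(1,2,3)]) (assumption, rule that)
  have "\<exists>U. open U \<and> u \<in> U \<and> uniform_limit (U \<inter> S) F f sequentially" if "u \<notin> \<Union>\<D>" for u
  proof (intro exI conjI)
    show "open (- closure (\<Union>\<B>))" by (intro open_Compl closed_closure)
    show "u \<in> - closure (\<Union>\<B>)" using that \<D>(3) by blast
    show "uniform_limit (- closure (\<Union>\<B>) \<inter> S) F f sequentially"
      using closure_subset[of "\<Union>\<B>"] by (intro uniform_limit_on_subset[OF \<B>(4)]) auto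
  qed
  then have "{u \<in> S. \<not> (\<exists>U. open U \<and> u \<in> U \<and> uniform_limit (U \<inter> S) F f sequentially)} \<subseteq> \<Union>\<D>"
    by blast
  then show "\<exists>\<D>. finite \<D> \<and> (\<forall>B\<in>\<D>. is_brick B) \<and>
      {u \<in> S. \<not> (\<exists>U. open U \<and> u \<in> U \<and> uniform_limit (U \<inter> S) F f sequentially)} \<subseteq> \<Union>\<D> \<and>
      (\<Sum>B\<in>\<D>. brick_volume B) < \<epsilon>"
    using \<D>(1,2,4) by (intro exI[of _ \<D>]) simp
qed

text \<open>Near \<open>u\<close> some \<open>g m\<close> is within \<open>e\<close> of
  \<open>f\<close> and takes a single value \<open>p\<close> on \<open>W\<close>. All averages over
  small bricks with interior in \<open>W\<close> are therefore within \<open>e\<close> of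
  \<open>p\<close>, and the Cauchy criterion applies.\<close>

lemma integral_quotient_converges:
  fixes f :: "real ^ 'n \<Rightarrow> real"
  assumes f: "\<And>S. S \<in> closed_subbricks a b \<Longrightarrow> f integrable_on S"
    and U: "open U" "u \<in> U" "uniform_limit (U \<inter> cbox a b) g f sequentially"
    and const: "\<And>m. \<exists>p. \<forall>\<^sub>F x in nhds u. x \<in> W \<inter> cbox a b \<longrightarrow> g m x = p"
  shows "\<exists>t. \<forall>e>0. \<exists>d>0. \<forall>S\<in>closed_subbricks a b.
    brick_volume S > 0 \<and> S \<subseteq> ball u d \<and> interior S \<subseteq> W \<longrightarrow> \<bar>integral S f / brick_volume S - t\<bar> < e"
proof -
  let ?A = "\<lambda>d. {S \<in> closed_subbricks a b. brick_volume S > 0 \<and> S \<subseteq> ball u d \<and> interior S \<subseteq> W}"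
  let ?q = "\<lambda>S. integral S f / brick_volume S"
  have "\<exists>t. \<forall>e>0. \<exists>d>0. \<forall>S\<in>?A d. \<bar>?q S - t\<bar> < e"
  proof (rule near_constant_imp_limit)
    show "?A d \<subseteq> ?A d'" if "d \<le> d'" for d d'
      using subset_ball[OF that, of u] by blast
    fix e :: real assume e: "e > 0"
    obtain m where m: "\<And>x. x \<in> U \<inter> cbox a b \<Longrightarrow> dist (g m x) (f x) < e"
      using uniform_limitD[OF U(3) e] by (auto simp: eventually_sequentially)
    obtain p where "\<forall>\<^sub>F x in nhds u. x \<in> W \<inter> cbox a b \<longrightarrow> g m x = p"
      using const by blast
    then have "\<forall>\<^sub>F x in nhds u. x \<in> U \<and> (x \<in> W \<inter> cbox a b \<longrightarrow> g m x = p)"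
      by (intro eventually_conj eventually_nhds_in_open U)
    then obtain d where d: "d > 0" "\<And>x. dist x u < d \<Longrightarrow> x \<in> U \<and> (x \<in> W \<inter> cbox a b \<longrightarrow> g m x = p)"
      unfolding eventually_nhds_metric by blast
    have "\<bar>?q S - p\<bar> \<le> e" if S: "S \<in> ?A d" for S
    proof -
      have S': "S \<in> closed_subbricks a b" "brick_volume S > 0" "S \<subseteq> ball u d" "interior S \<subseteq> W"
        using S by simp_all
      have sub: "S \<subseteq> cbox a b"
        using S'(1) by (simp add: closed_subbricks_iff)
      have dev: "\<bar>f x - p\<bar> \<le> e" if x: "x \<in> interior S" for x
      proof -
        have "x \<in> S" using x interior_subset by blast
        then have "dist x u < d" "x \<in> W \<inter> cbox a b"
          using S'(3,4) sub x by (auto simp: dist_commute)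
        then show ?thesis
          using d(2)[of x] m[of x] by (auto simp: dist_real_def)
      qed
      have "\<bar>integral S f - p * brick_volume S\<bar> \<le> e * brick_volume S"
        by (rule integral_deviation_le[OF S'(1) f[OF S'(1)] less_imp_le[OF e] dev])
      moreover have "?q S - p = (integral S f - p * brick_volume S) / brick_volume S"
        using S'(2) by (simp add: field_simps)
      ultimately show ?thesis
        using S'(2) by (simp add: abs_divide divide_le_eq)
    qed
    then show "\<exists>c. \<exists>d>0. \<forall>S\<in>?A d. \<bar>?q S - c\<bar> \<le> e"
      using d(1) by blast
  qed
  then show ?thesis
    by (simp add: Ball_def imp_conjL)
qed

section \<open>Closed quadrants as boxes\<close>

definition quadrant_lo :: "real ^ 'n \<Rightarrow> real ^ 'n \<Rightarrow> int ^ 'n \<Rightarrow> real ^ 'n" where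
  "quadrant_lo a u \<alpha> = (\<chi> k. if \<alpha> $ k = -1 then a $ k else u $ k)"

definition quadrant_hi :: "real ^ 'n \<Rightarrow> real ^ 'n \<Rightarrow> int ^ 'n \<Rightarrow> real ^ 'n" where
  "quadrant_hi b u \<alpha> = (\<chi> k. if \<alpha> $ k = -1 then u $ k else b $ k)"

lemma box_subset_quadrant: "box (quadrant_lo a u \<alpha>) (quadrant_hi b u \<alpha>) \<subseteq> quadrant a b u \<alpha>"
proof
  fix x assume x: "x \<in> box (quadrant_lo a u \<alpha>) (quadrant_hi b u \<alpha>)"
  have "x $ k \<in> (if \<alpha> $ k = -1 then {a $ k ..< u $ k} else {u $ k <.. b $ k})" for k
  proof -
    have "quadrant_lo a u \<alpha> $ k < x $ k" "x $ k < quadrant_hi b u \<alpha> $ k"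
      using x by (simp_all add: mem_box_cart)
    then show ?thesis
      by (cases "\<alpha> $ k = -1") (simp_all add: quadrant_lo_def quadrant_hi_def)
  qed
  then show "x \<in> quadrant a b u \<alpha>"
    by (simp add: quadrant_def)
qed

lemma quadrant_subset_cbox: "quadrant a b u \<alpha> \<subseteq> cbox (quadrant_lo a u \<alpha>) (quadrant_hi b u \<alpha>)"
proof
  fix x assume x: "x \<in> quadrant a b u \<alpha>"
  have "quadrant_lo a u \<alpha> $ k \<le> x $ k \<and> x $ k \<le> quadrant_hi b u \<alpha> $ k" for k
  proof -
    have "x $ k \<in> (if \<alpha> $ k = -1 then {a $ k ..< u $ k} else {u $ k <.. b $ k})"
      using x by (simp add: quadrant_def)
    then show ?thesis
      by (cases "\<alpha> $ k = -1") (simp_all add: quadrant_lo_def quadrant_hi_def)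
  qed
  then show "x \<in> cbox (quadrant_lo a u \<alpha>) (quadrant_hi b u \<alpha>)"
    by (simp add: mem_box_cart)
qed

text \<open>The quadrant lies between the open and the closed box with the same corners. As
  \<open>u\<close> is an interior point, the open box is nonempty and its closure is the closed
  box.\<close>

lemma closure_quadrant:
  assumes "u \<in> box a b"
  shows "closure (quadrant a b u \<alpha>) = cbox (quadrant_lo a u \<alpha>) (quadrant_hi b u \<alpha>)"
proof (rule subset_antisym)
  show "closure (quadrant a b u \<alpha>) \<subseteq> cbox (quadrant_lo a u \<alpha>) (quadrant_hi b u \<alpha>)"
    by (intro closure_minimal quadrant_subset_cbox closed_cbox)
  have "box (quadrant_lo a u \<alpha>) (quadrant_hi b u \<alpha>) \<noteq> {}"
    using assms by (simp add: interval_ne_empty_cart quadrant_lo_def quadrant_hi_def mem_box_cart)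
  then show "cbox (quadrant_lo a u \<alpha>) (quadrant_hi b u \<alpha>) \<subseteq> closure (quadrant a b u \<alpha>)"
    using closure_mono[OF box_subset_quadrant[of a u \<alpha> b]] by simp
qed

text \<open>A brick in the closed quadrant may touch the hyperplanes through \<open>u\<close>, where
  step functions can take other values; its interior stays off them.\<close>

lemma interior_subset_quadrant:
  assumes "u \<in> box a b" "S \<subseteq> closure (quadrant a b u \<alpha>)"
  shows "interior S \<subseteq> quadrant a b u \<alpha>"
  using interior_mono[OF assms(2)[unfolded closure_quadrant[OF assms(1)]]]
    box_subset_quadrant[of a u \<alpha> b] by simp

lemma AE_lebesgue_on_iff_negligible:
  assumes "T \<in> sets lebesgue"
  shows "(AE x in lebesgue_on T. P x) \<longleftrightarrow> negligible {x \<in> T. \<not> P x}"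
proof
  assume "AE x in lebesgue_on T. P x"
  then obtain N where "N \<in> null_sets (lebesgue_on T)" "{x \<in> T. \<not> P x} \<subseteq> N"
    by (auto simp: eventually_ae_filter)
  then show "negligible {x \<in> T. \<not> P x}"
    using assms by (auto simp: null_sets_restrict_space negligible_iff_null_sets[symmetric] intro: negligible_subset)
next
  assume "negligible {x \<in> T. \<not> P x}"
  then have "{x \<in> T. \<not> P x} \<in> null_sets (lebesgue_on T)"
    using assms by (simp add: null_sets_restrict_space negligible_iff_null_sets)
  then show "AE x in lebesgue_on T. P x"
    by (rule AE_I') simp
qed

section \<open>Necessity of the four conditions\<close>

text \<open>One Jordan null set \<open>J\<close>, where local uniformity fails or the boundary is
  met, handles all directions. The unrestricted derivative also requires \<open>u\<close> to avoid
  the frontiers of the bricks in the approximating step functions.\<close>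

lemma K_integrable_strongly_differentiable:
  fixes f :: "real ^ 'n \<Rightarrow> real"
  assumes le: "\<And>i. a $ i \<le> b $ i" and f: "f K_integrable_on cbox a b"
    and \<Psi>: "\<And>S. S \<in> closed_subbricks a b \<Longrightarrow> \<Psi> S = integral S f"
  shows "negligible {u \<in> cbox a b. \<not> strongly_differentiable a b \<Psi> u}"
    and "jordan_null {u \<in> cbox a b. \<exists>\<alpha>\<in>directions. \<not> strongly_differentiable_dir a b \<Psi> \<alpha> u}"
proof -
  obtain g where g: "\<And>m. step_function_on (cbox a b) (g m)" "nearly_uniform_limit (cbox a b) g f"
    by (rule K_integrable_onE[OF f]) (rule that)
  have int: "f integrable_on S" if "S \<in> closed_subbricks a b" for S
    using that K_integrable_on_subbrick[OF f] K_integrable_imp_integrable closed_subbricks_brick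
    by (metis closed_subbricks_iff)
  define J where "J = (cbox a b - box a b) \<union>
    {u \<in> cbox a b. \<not> (\<exists>U. open U \<and> u \<in> U \<and> uniform_limit (U \<inter> cbox a b) g f sequentially)}"
  have J: "jordan_null J"
    unfolding J_def by (intro jordan_null_Un jordan_null_cbox_diff_box nearly_uniform_limit_locally_uniform g le)
  have limit: "\<exists>t. \<forall>e>0. \<exists>d>0. \<forall>S\<in>closed_subbricks a b.
      brick_volume S > 0 \<and> S \<subseteq> ball u d \<and> interior S \<subseteq> W \<longrightarrow> \<bar>\<Psi> S / brick_volume S - t\<bar> < e"
    if u: "u \<in> cbox a b - J"
      and W: "\<And>m. \<exists>p. \<forall>\<^sub>F x in nhds u. x \<in> W \<inter> cbox a b \<longrightarrow> g m x = p" for u W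
  proof -
    obtain U where U: "open U" "u \<in> U" "uniform_limit (U \<inter> cbox a b) g f sequentially"
      using u by (auto simp: J_def)
    show ?thesis
      using integral_quotient_converges[OF int U W] \<Psi> by simp
  qed
  have "\<forall>m. \<exists>M c B. step_representation (cbox a b) (g m) M c B"
    using g(1) by (simp add: step_function_on_def)
  then obtain M c B where B: "\<And>m. step_representation (cbox a b) (g m) (M m) (c m) (B m)"
    unfolding choice_iff by blast
  have brick: "is_brick (B m j)" if "j < M m" for m j
    using B[of m] that by (simp add: step_representation_def)
  \<comment> \<open>A countable union of frontiers is negligible but can be dense, so this part is
    obtained Lebesgue rather than Jordan almost everywhere.\<close>
  define Z where "Z = J \<union> (\<Union>m. \<Union>j<M m. frontier (B m j))"
  have "negligible (\<Union>j<M m. frontier (B m j))" for m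
    by (intro negligible_Union) (auto intro: negligible_frontier_brick brick)
  then have "negligible Z"
    unfolding Z_def using jordan_null_imp_negligible[OF J]
    by (intro negligible_Un negligible_countable_Union) auto
  moreover have "strongly_differentiable a b \<Psi> u" if u: "u \<in> cbox a b - Z" for u
  proof -
    have "\<exists>p. \<forall>\<^sub>F x in nhds u. x \<in> UNIV \<longrightarrow> indicat_real (B m j) x = p" if "j < M m" for m j
      using brick_eventually_off_frontier[of u "B m j"] u that by (auto simp: Z_def)
    then have "\<exists>p. \<forall>\<^sub>F x in nhds u. x \<in> UNIV \<inter> cbox a b \<longrightarrow> g m x = p" for m
      by (rule step_representation_eventually_constant[OF B])
    then show ?thesis
      using limit[of u UNIV] u
      by (simp add: strongly_differentiable_def has_strong_derivative_def Z_def J_def)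
  qed
  ultimately show "negligible {u \<in> cbox a b. \<not> strongly_differentiable a b \<Psi> u}"
    by (elim negligible_subset) blast
  have "strongly_differentiable_dir a b \<Psi> \<alpha> u" if u: "u \<in> cbox a b - J" for u \<alpha>
  proof -
    have box: "u \<in> box a b"
      using u by (simp add: J_def)
    have "\<exists>p. \<forall>\<^sub>F x in nhds u. x \<in> quadrant a b u \<alpha> \<inter> cbox a b \<longrightarrow> g m x = p" for m
      by (rule step_representation_eventually_constant[OF B]) (rule brick_eventually_in_quadrant[OF brick])
    then obtain t where t: "\<forall>e>0. \<exists>d>0. \<forall>S\<in>closed_subbricks a b. brick_volume S > 0 \<and>
        S \<subseteq> ball u d \<and> interior S \<subseteq> quadrant a b u \<alpha> \<longrightarrow> \<bar>\<Psi> S / brick_volume S - t\<bar> < e"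
      using limit[OF u] by blast
    have "has_strong_derivative_dir a b \<Psi> \<alpha> u t"
      unfolding has_strong_derivative_dir_def
    proof (intro conjI allI impI)
      show "u \<in> interior (cbox a b)" using box by simp
      fix e :: real assume "e > 0"
      then have "\<exists>d>0. \<forall>S\<in>closed_subbricks a b. brick_volume S > 0 \<and>
          S \<subseteq> ball u d \<and> interior S \<subseteq> quadrant a b u \<alpha> \<longrightarrow> \<bar>\<Psi> S / brick_volume S - t\<bar> < e"
        using t by simp
      then obtain d where d: "d > 0" "\<forall>S\<in>closed_subbricks a b. brick_volume S > 0 \<and>
          S \<subseteq> ball u d \<and> interior S \<subseteq> quadrant a b u \<alpha> \<longrightarrow> \<bar>\<Psi> S / brick_volume S - t\<bar> < e"
        by (elim exE conjE) (rule that)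
      show "\<exists>d>0. \<forall>S\<in>closed_subbricks a b. brick_volume S > 0 \<and>
          S \<subseteq> ball u d \<inter> closure (quadrant a b u \<alpha>) \<longrightarrow> \<bar>\<Psi> S / brick_volume S - t\<bar> < e"
      proof (intro exI conjI ballI impI, rule d(1))
        fix S assume S: "S \<in> closed_subbricks a b"
          "brick_volume S > 0 \<and> S \<subseteq> ball u d \<inter> closure (quadrant a b u \<alpha>)"
        then have "interior S \<subseteq> quadrant a b u \<alpha>"
          by (intro interior_subset_quadrant[OF box]) simp
        then show "\<bar>\<Psi> S / brick_volume S - t\<bar> < e"
          using d(2) S by simp
      qed
    qed
    then show ?thesis
      unfolding strongly_differentiable_dir_def ..
  qed
  then show "jordan_null {u \<in> cbox a b. \<exists>\<alpha>\<in>directions. \<not> strongly_differentiable_dir a b \<Psi> \<alpha> u}"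
    by (intro jordan_null_subset[OF J]) blast
qed

text \<open>The constant comes from the uniform bound on the step functions, since \<open>f\<close>
  itself may be unbounded on a null set. The estimate for their integrals survives the
  limit.\<close>

lemma K_integrable_brick_lipschitz:
  fixes f :: "real ^ 'n \<Rightarrow> real"
  assumes f: "f K_integrable_on cbox a b"
    and \<Psi>: "\<And>S. S \<in> closed_subbricks a b \<Longrightarrow> \<Psi> S = integral S f"
  shows "brick_lipschitz a b \<Psi>"
proof -
  obtain g where g: "\<And>m. step_function_on (cbox a b) (g m)" "nearly_uniform_limit (cbox a b) g f"
    by (rule K_integrable_onE[OF f]) (rule that)
  then obtain K where K: "\<And>m x. x \<in> cbox a b \<Longrightarrow> \<bar>g m x\<bar> \<le> K"
    unfolding nearly_uniform_limit_def by blast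
  \<comment> \<open>Taking the maximum with 1 makes the Lipschitz constant strictly
    positive.\<close>
  define L where "L = max K 1"
  have L: "L > 0" "K \<le> L"
    by (simp_all add: L_def)
  have "\<bar>\<Psi> S\<bar> \<le> L * brick_volume S" if S: "S \<in> closed_subbricks a b" for S
  proof -
    obtain \<alpha> \<beta> where c: "S = cbox \<alpha> \<beta>" "cbox \<alpha> \<beta> \<noteq> {}" "S \<subseteq> cbox a b"
      by (rule closed_subbricksE[OF S]) (rule that)
    have brick: "is_brick S"
      by (rule closed_subbricks_brick[OF S])
    have step: "step_function_on S (g m)" for m
      by (rule step_function_on_subbrick[OF g(1) brick c(3)])
    have "norm (step_integral S (g m)) \<le> L * measure lborel (cbox \<alpha> \<beta>)" for m
    proof (rule has_integral_bound)
      show "(g m has_integral step_integral S (g m)) (cbox \<alpha> \<beta>)"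
        using step_function_has_integral[OF step] by (simp add: c(1))
      show "norm (g m x) \<le> L" if "x \<in> cbox \<alpha> \<beta>" for x
        using K[of x m] L(2) that c(1,3) by auto
    qed (use L in simp)
    then have "\<bar>step_integral S (g m)\<bar> \<le> L * brick_volume S" for m
      using closed_subbricks_content[OF S] by (simp add: c(1))
    moreover have "(\<lambda>m. \<bar>step_integral S (g m)\<bar>) \<longlonglongrightarrow> \<bar>\<Psi> S\<bar>"
      unfolding \<Psi>[OF S]
      by (intro tendsto_rabs step_integral_tendsto[OF brick step] nearly_uniform_limit_subbrick[OF g(2) brick c(3)])
    ultimately show ?thesis
      by (intro LIMSEQ_le_const2) auto
  qed
  then show ?thesis
    unfolding brick_lipschitz_def using L(1) by blast
qed

text \<open>Two boxes with disjoint interiors meet in a convex set without interior, hence in a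
  negligible set, so their integrals add.\<close>

lemma integral_finitely_additive:
  fixes f :: "real ^ 'n \<Rightarrow> real"
  assumes f: "\<And>S. S \<in> closed_subbricks a b \<Longrightarrow> f integrable_on S"
    and \<Psi>: "\<And>S. S \<in> closed_subbricks a b \<Longrightarrow> \<Psi> S = integral S f"
  shows "finitely_additive a b \<Psi>"
  unfolding finitely_additive_def
proof (intro allI impI, elim conjE)
  fix S P and m :: nat
  assume S: "S \<in> closed_subbricks a b" and P: "\<forall>i\<in>{1..m}. P i \<in> closed_subbricks a b"
    and SP: "S = (\<Union>i\<in>{1..m}. P i)"
    and disj: "\<forall>i\<in>{1..m}. \<forall>j\<in>{1..m}. i \<noteq> j \<longrightarrow> interior (P i) \<inter> interior (P j) = {}"
  have "(f has_integral (\<Sum>i=1..m. integral (P i) f)) (\<Union>i\<in>{1..m}. P i)"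
  proof (rule has_integral_UN)
    show "(f has_integral integral (P i) f) (P i)" if "i \<in> {1..m}" for i
      using P f that by (simp add: integrable_integral)
    show "pairwise (\<lambda>i j. negligible (P i \<inter> P j)) {1..m}"
    proof (rule pairwiseI)
      fix i j assume ij: "i \<in> {1..m}" "j \<in> {1..m}" "i \<noteq> j"
      have "convex (P k)" if "k \<in> {1..m}" for k
        by (rule closed_subbricksE[OF bspec[OF P that]]) simp
      then have "convex (P i \<inter> P j)"
        using ij by (simp add: convex_Int)
      moreover have "interior (P i \<inter> P j) = {}"
        using disj ij by simp
      ultimately show "negligible (P i \<inter> P j)"
        by (simp add: negligible_convex_interior)
    qed
  qed simp
  then have "integral S f = (\<Sum>i=1..m. integral (P i) f)"
    unfolding SP by (rule integral_unique)
  then show "\<Psi> S = (\<Sum>i=1..m. \<Psi> (P i))"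
    using P \<Psi> S by simp
qed

section \<open>Approximation by step functions on a grid\<close>

text \<open>The derivative at \<open>v\<close> is approximated by averages over arbitrarily small
  bricks with lower corner \<open>v\<close>. A bound valid for these averages near \<open>v\<close>
  therefore passes to the derivative.\<close>

lemma strong_derivative_dir_close:
  assumes t: "has_strong_derivative_dir a b \<Psi> (\<chi> k. 1) v t"
    and U: "open U" "v \<in> U"
    and le: "\<And>S. S \<in> closed_subbricks a b \<Longrightarrow> brick_volume S > 0 \<Longrightarrow> S \<subseteq> U \<Longrightarrow> S \<subseteq> cbox v b \<Longrightarrow>
      \<bar>\<Psi> S / brick_volume S - s\<bar> \<le> e"
  shows "\<bar>t - s\<bar> \<le> e"
proof (rule field_le_epsilon)
  fix \<epsilon> :: real assume \<epsilon>: "\<epsilon> > 0"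
  have v: "v \<in> box a b"
    using t by (simp add: has_strong_derivative_dir_def)
  have "\<exists>d>0. \<forall>S\<in>closed_subbricks a b. brick_volume S > 0 \<and>
      S \<subseteq> ball v d \<inter> closure (quadrant a b v (\<chi> k. 1)) \<longrightarrow> \<bar>\<Psi> S / brick_volume S - t\<bar> < \<epsilon>"
    using t \<epsilon> by (simp add: has_strong_derivative_dir_def)
  then obtain d where d: "d > 0" "\<forall>S\<in>closed_subbricks a b. brick_volume S > 0 \<and>
      S \<subseteq> ball v d \<inter> closure (quadrant a b v (\<chi> k. 1)) \<longrightarrow> \<bar>\<Psi> S / brick_volume S - t\<bar> < \<epsilon>"
    by (elim exE conjE) (rule that)
  have "open (U \<inter> box a b \<inter> ball v d)" "v \<in> U \<inter> box a b \<inter> ball v d"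
    using U v d(1) by auto
  \<comment> \<open>Only the upper corner \<open>q\<close> matters for the test brick
    \<open>cbox v q\<close>; since \<open>v\<close> is strictly inside \<open>box p q\<close>, that
    brick has positive volume.\<close>
  then obtain p q where pq: "cbox p q \<subseteq> U \<inter> box a b \<inter> ball v d" "v \<in> box p q"
    by (rule open_contains_cbox)
  have less: "v $ k < q $ k" "p $ k < v $ k" for k
    using pq(2) by (simp_all add: mem_box_cart)
  have sub: "cbox v q \<subseteq> cbox p q"
    using less by (auto simp: subset_interval_cart intro: less_imp_le)
  have ne: "cbox v q \<noteq> {}"
    using less(1) by (simp add: interval_ne_empty_cart less_imp_le)
  have S: "cbox v q \<in> closed_subbricks a b"
    unfolding closed_subbricks_iff using sub pq(1) ne box_subset_cbox[of a b] by blast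
  have pos: "brick_volume (cbox v q) > 0"
    unfolding closed_subbricks_content[OF S, symmetric] content_cbox_cart[OF ne] using less(1)
    by (intro prod_pos) simp
  have "cbox v q \<subseteq> cbox v b"
    using S ne by (auto simp: closed_subbricks_iff subset_interval_cart)
  moreover have "quadrant_lo a v (\<chi> k. 1) = v" "quadrant_hi b v (\<chi> k. 1) = b"
    by (simp_all add: quadrant_lo_def quadrant_hi_def vec_eq_iff)
  ultimately have "\<bar>\<Psi> (cbox v q) / brick_volume (cbox v q) - s\<bar> \<le> e"
      "\<bar>\<Psi> (cbox v q) / brick_volume (cbox v q) - t\<bar> < \<epsilon>"
    using le[OF S pos] d(2) S pos sub pq(1) by (auto simp: closure_quadrant[OF v])
  then show "\<bar>t - s\<bar> \<le> e + \<epsilon>"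
    by linarith
qed

text \<open>The definition of \<open>s\<close> bounds all averages over small bricks above
  \<open>v\<close>, which is the hypothesis of \<open>strong_derivative_dir_close\<close> with
  \<open>s\<close> in the role of the target.\<close>

lemma strong_derivative_dir_unique:
  assumes t: "has_strong_derivative_dir a b \<Psi> (\<chi> k. 1) v t"
    and s: "has_strong_derivative_dir a b \<Psi> (\<chi> k. 1) v s"
  shows "t = s"
proof -
  have v: "v \<in> box a b"
    using t by (simp add: has_strong_derivative_dir_def)
  have "\<bar>t - s\<bar> \<le> 0 + e" if e: "e > 0" for e
  proof -
    have "\<exists>d>0. \<forall>S\<in>closed_subbricks a b. brick_volume S > 0 \<and>
        S \<subseteq> ball v d \<inter> closure (quadrant a b v (\<chi> k. 1)) \<longrightarrow> \<bar>\<Psi> S / brick_volume S - s\<bar> < e"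
      using s e by (simp add: has_strong_derivative_dir_def)
    then obtain d where d: "d > 0" "\<forall>S\<in>closed_subbricks a b. brick_volume S > 0 \<and>
        S \<subseteq> ball v d \<inter> closure (quadrant a b v (\<chi> k. 1)) \<longrightarrow> \<bar>\<Psi> S / brick_volume S - s\<bar> < e"
      by (elim exE conjE) (rule that)
    have "quadrant_lo a v (\<chi> k. 1) = v" "quadrant_hi b v (\<chi> k. 1) = b"
      by (simp_all add: quadrant_lo_def quadrant_hi_def vec_eq_iff)
    then have "closure (quadrant a b v (\<chi> k. 1)) = cbox v b"
      by (simp add: closure_quadrant[OF v])
    then have "\<bar>t - s\<bar> \<le> e"
      using d by (intro strong_derivative_dir_close[OF t, of "ball v d"]) (auto intro!: less_imp_le)
    then show ?thesis by simp
  qed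
  then have "\<bar>t - s\<bar> \<le> 0"
    by (rule field_le_epsilon)
  then show ?thesis by simp
qed

section \<open>Step functions constant on the cells of a half-open grid\<close>

text \<open>By compactness finitely many of the neighbourhoods in \<open>osc\<close> cover
  \<open>C\<close>. A grid through their centres and ends is so fine that two points of
  \<open>C\<close> in one cell lie in a common neighbourhood, on the same sides of its centre. Ties
  count as the upper side, matching cells closed below and open above.\<close>

lemma step_function_approximation:
  fixes f :: "real ^ 'n \<Rightarrow> real" and C :: "(real ^ 'n) set"
  assumes C: "compact C" "C \<subseteq> cbox a b" and L: "0 \<le> L" "\<And>x. x \<in> C \<Longrightarrow> \<bar>f x\<bar> \<le> L"
    and osc: "\<And>u. u \<in> C \<Longrightarrow> \<exists>d>0. \<forall>v\<in>C. \<forall>w\<in>C.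
      (\<forall>k. \<bar>v $ k - u $ k\<bar> \<le> d \<and> \<bar>w $ k - u $ k\<bar> \<le> d \<and> (v $ k < u $ k \<longleftrightarrow> w $ k < u $ k)) \<longrightarrow> \<bar>f v - f w\<bar> \<le> e"
  shows "\<exists>g. step_function_on (cbox a b) g \<and> (\<forall>x\<in>C. \<bar>g x - f x\<bar> \<le> e) \<and> (\<forall>x. \<bar>g x\<bar> \<le> L)"
proof -
  have "\<forall>u\<in>C. \<exists>d. d > 0 \<and> (\<forall>v\<in>C. \<forall>w\<in>C.
      (\<forall>k. \<bar>v $ k - u $ k\<bar> \<le> d \<and> \<bar>w $ k - u $ k\<bar> \<le> d \<and> (v $ k < u $ k \<longleftrightarrow> w $ k < u $ k)) \<longrightarrow> \<bar>f v - f w\<bar> \<le> e)"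
    using osc by simp
  then have "\<exists>d. \<forall>u\<in>C. d u > 0 \<and> (\<forall>v\<in>C. \<forall>w\<in>C.
      (\<forall>k. \<bar>v $ k - u $ k\<bar> \<le> d u \<and> \<bar>w $ k - u $ k\<bar> \<le> d u \<and> (v $ k < u $ k \<longleftrightarrow> w $ k < u $ k)) \<longrightarrow> \<bar>f v - f w\<bar> \<le> e)"
    by (rule bchoice)
  then obtain d where d': "\<forall>u\<in>C. d u > 0 \<and> (\<forall>v\<in>C. \<forall>w\<in>C.
      (\<forall>k. \<bar>v $ k - u $ k\<bar> \<le> d u \<and> \<bar>w $ k - u $ k\<bar> \<le> d u \<and> (v $ k < u $ k \<longleftrightarrow> w $ k < u $ k)) \<longrightarrow> \<bar>f v - f w\<bar> \<le> e)"
    ..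
  have d: "d u > 0" if "u \<in> C" for u
    using d' that by simp
  have fd: "\<bar>f v - f w\<bar> \<le> e" if "u \<in> C" "v \<in> C" "w \<in> C"
    "\<And>k. \<bar>v $ k - u $ k\<bar> \<le> d u" "\<And>k. \<bar>w $ k - u $ k\<bar> \<le> d u"
    "\<And>k. v $ k < u $ k \<longleftrightarrow> w $ k < u $ k" for u v w
    using d' that by blast
  define Q where "Q = (\<lambda>u. box (\<chi> k. u $ k - d u) (\<chi> k. u $ k + d u))"
  have Q: "x \<in> Q u \<longleftrightarrow> (\<forall>k. u $ k - d u < x $ k \<and> x $ k < u $ k + d u)" for x u
    by (simp add: Q_def mem_box_cart)
  have "C \<subseteq> (\<Union>u\<in>C. Q u)"
    using d by (auto simp: Q)
  then obtain D where D: "D \<subseteq> C" "finite D" "C \<subseteq> (\<Union>u\<in>D. Q u)"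
    by (rule compactE_image[OF C(1), rotated]) (simp_all add: Q_def open_box)
  \<comment> \<open>All coordinates share one finite set of mesh points. The centres
    \<open>u $ k\<close> force points of one cell onto the same side; the two ends keep them in one
    neighbourhood.\<close>
  define E where "E = (\<Union>u\<in>D. \<Union>k. {u $ k, u $ k - d u, u $ k + d u})"
  have finE: "finite E"
    using D(2) by (simp add: E_def)
  \<comment> \<open>Two points have the same key iff they lie in the same cell of the half-open grid with mesh points \<open>E\<close>.\<close>
  define key where "key = (\<lambda>x :: real ^ 'n. \<lambda>k. {c \<in> E. x $ k < c})"
  define cell where "cell = (\<lambda>\<kappa>. {x \<in> cbox a b. key x = \<kappa>})"
  have key_eqD: "x $ k < c \<longleftrightarrow> y $ k < c" if "key x = key y" "c \<in> E" for x y k c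
    using that(2) fun_cong[OF that(1), of k] by (auto simp: key_def)
  have close: "\<bar>f x - f y\<bar> \<le> e" if xy: "x \<in> C" "y \<in> C" "key x = key y" for x y
  proof -
    obtain u where u: "u \<in> D" "x \<in> Q u"
      using D(3) xy(1) by blast
    have E: "u $ k \<in> E" "u $ k - d u \<in> E" "u $ k + d u \<in> E" for k
      using u(1) by (auto simp: E_def)
    have x: "u $ k - d u < x $ k" "x $ k < u $ k + d u" for k
      using u(2) by (simp_all add: Q)
    \<comment> \<open>The grid records only whether a coordinate is below a mesh point, so
      \<open>y\<close> may lie on the lower face of the neighbourhood; hence the non-strict bounds
      in \<open>osc\<close>.\<close>
    have y: "u $ k - d u \<le> y $ k" "y $ k < u $ k + d u" for k
      using key_eqD[OF xy(3) E(2), of k k] key_eqD[OF xy(3) E(3), of k k] x[of k] by simp_all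
    show ?thesis
    proof (rule fd)
      show "\<bar>x $ k - u $ k\<bar> \<le> d u" "\<bar>y $ k - u $ k\<bar> \<le> d u" "x $ k < u $ k \<longleftrightarrow> y $ k < u $ k" for k
        using x[of k] y[of k] key_eqD[OF xy(3) E(1), of k k] by (simp_all add: abs_le_iff)
    qed (use u(1) D(1) xy(1,2) in auto)
  qed
  define A where "A = key ` cbox a b"
  have "A \<subseteq> (\<Pi>\<^sub>E k\<in>UNIV. Pow E)"
    by (auto simp: A_def key_def)
  then have finA: "finite A"
    using finE by (elim finite_subset) (intro finite_PiE, simp_all)
  \<comment> \<open>The value of a cell is sampled at a point of \<open>C\<close>, where
    \<open>f\<close> is controlled. Cells that miss \<open>C\<close> get zero, which also respects
    the bound \<open>L\<close>.\<close>
  define val where "val = (\<lambda>\<kappa>. if cell \<kappa> \<inter> C = {} then 0 else f (SOME x. x \<in> cell \<kappa> \<inter> C))"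
  have val: "\<exists>y\<in>C. key y = key x \<and> val (key x) = f y" if "x \<in> C" for x
  proof -
    have "x \<in> cell (key x) \<inter> C"
      using that C(2) by (auto simp: cell_def)
    then have "(SOME y. y \<in> cell (key x) \<inter> C) \<in> cell (key x) \<inter> C" "val (key x) = f (SOME y. y \<in> cell (key x) \<inter> C)"
      by (rule someI, auto simp: val_def)
    then show ?thesis
      by (intro bexI[of _ "SOME y. y \<in> cell (key x) \<inter> C"]) (simp_all add: cell_def)
  qed
  have val_le: "\<bar>val \<kappa>\<bar> \<le> L" for \<kappa>
  proof (cases "cell \<kappa> \<inter> C = {}")
    case False
    then have "(SOME y. y \<in> cell \<kappa> \<inter> C) \<in> cell \<kappa> \<inter> C"
      by (simp only: some_in_eq not_False_eq_True)
    then show ?thesis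
      using L(2) False by (simp add: val_def)
  qed (simp add: val_def L(1))
  define g where "g = (\<lambda>x. if x \<in> cbox a b then val (key x) else 0)"
  have "step_function_on (cbox a b) g"
  proof (rule step_function_onI[OF finA])
    fix \<kappa> assume "\<kappa> \<in> A"
    then obtain x where x: "x \<in> cbox a b" "key x = \<kappa>"
      by (auto simp: A_def)
    \<comment> \<open>These are the factors of the cell. They are intervals because the set of mesh
      points above \<open>y\<close> shrinks as \<open>y\<close> grows.\<close>
    define I where "I = (\<lambda>k. {y. a $ k \<le> y \<and> y \<le> b $ k \<and> {c \<in> E. y < c} = \<kappa> k})"
    have I1: "is_interval (I k)" for k
      unfolding is_interval_1
    proof (intro ballI allI impI)
      fix p q y assume pq: "p \<in> I k" "q \<in> I k" and y: "p \<le> y \<and> y \<le> q"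
      have "{c \<in> E. q < c} \<subseteq> {c \<in> E. y < c}" "{c \<in> E. y < c} \<subseteq> {c \<in> E. p < c}"
        using y by auto
      moreover have "{c \<in> E. p < c} = \<kappa> k" "{c \<in> E. q < c} = \<kappa> k" "a $ k \<le> p" "q \<le> b $ k"
        using pq by (simp_all add: I_def)
      ultimately show "y \<in> I k"
        using y by (simp add: I_def subset_antisym)
    qed
    have I2: "bounded (I k)" for k
    proof (rule bounded_subset)
      show "I k \<subseteq> {a $ k..b $ k}"
        by (rule subsetI) (simp add: I_def)
    qed simp
    have I3: "I k \<noteq> {}" for k
    proof -
      have "x $ k \<in> I k"
        using x by (auto simp: I_def mem_box_cart key_def)
      then show ?thesis by blast
    qed
    have cell: "cell \<kappa> = {y. \<forall>k. y $ k \<in> I k}"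
      by (simp add: cell_def key_def interval_cart fun_eq_iff I_def all_conj_distrib conj_assoc)
    have "is_brick (cell \<kappa>)"
      unfolding cell by (rule is_brickI[OF I1 I2 I3])
    moreover have "cell \<kappa> \<subseteq> cbox a b"
      unfolding cell_def by blast
    ultimately show "is_brick (cell \<kappa>) \<and> cell \<kappa> \<subseteq> cbox a b" ..
  next
    fix x assume x: "x \<in> cbox a b"
    \<comment> \<open>The cells partition the closed brick, so only the cell of \<open>x\<close>
      contributes.\<close>
    have "(\<Sum>\<kappa>\<in>A. val \<kappa> * indicator (cell \<kappa>) x) = (\<Sum>\<kappa>\<in>A. if \<kappa> = key x then val \<kappa> else 0)"
      using x by (intro sum.cong) (auto simp: cell_def indicator_def)
    also have "\<dots> = g x"
      using x finA by (simp add: g_def A_def)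
    finally show "g x = (\<Sum>\<kappa>\<in>A. val \<kappa> * indicator (cell \<kappa>) x)" ..
  qed
  moreover have "\<bar>g x - f x\<bar> \<le> e" if x: "x \<in> C" for x
  proof -
    obtain y where "y \<in> C" "key y = key x" "val (key x) = f y"
      using val[OF x] by blast
    then show ?thesis
      using close[of y x] x C(2) by (auto simp: g_def)
  qed
  moreover have "\<bar>g x\<bar> \<le> L" for x
    using val_le L(1) by (simp add: g_def)
  ultimately show ?thesis by blast
qed

text \<open>On the compact set \<open>C m\<close> of points at distance at least \<rho>
  \<open>m\<close> from \<open>N\<close>, the grid gives a step function within \<rho>
  \<open>m\<close> of \<open>f\<close>. Outside any open brick cover of the closed cover of
  \<open>N\<close>, all points belong to \<open>C m\<close> once \<open>m\<close> is large.\<close>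

lemma K_integrable_if_small_oscillation:
  fixes f :: "real ^ 'n \<Rightarrow> real"
  assumes le: "\<And>i. a $ i \<le> b $ i" and N: "jordan_null N"
    and L: "0 \<le> L" "\<And>x. x \<in> cbox a b \<Longrightarrow> \<bar>f x\<bar> \<le> L"
    and osc: "\<And>u e. u \<in> cbox a b - N \<Longrightarrow> e > 0 \<Longrightarrow> \<exists>d>0. \<forall>v\<in>cbox a b - N. \<forall>w\<in>cbox a b - N.
      (\<forall>k. \<bar>v $ k - u $ k\<bar> \<le> d \<and> \<bar>w $ k - u $ k\<bar> \<le> d \<and> (v $ k < u $ k \<longleftrightarrow> w $ k < u $ k)) \<longrightarrow> \<bar>f v - f w\<bar> \<le> e"
  shows "f K_integrable_on cbox a b"
proof -
  define \<rho> where "\<rho> = (\<lambda>m. inverse (real (Suc m)))"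
  have \<rho>: "\<rho> m > 0" for m
    by (simp add: \<rho>_def)
  define C where "C = (\<lambda>m. cbox a b - (\<Union>y\<in>N. ball y (\<rho> m)))"
  have C: "compact (C m)" for m
    unfolding C_def by (intro compact_diff compact_cbox open_UN ballI open_ball)
  have CN: "C m \<subseteq> cbox a b - N" for m
    using \<rho>[of m] by (auto simp: C_def)
  have "\<exists>g. step_function_on (cbox a b) g \<and> (\<forall>x\<in>C m. \<bar>g x - f x\<bar> \<le> \<rho> m) \<and> (\<forall>x. \<bar>g x\<bar> \<le> L)" for m
  proof (rule step_function_approximation[OF C _ L(1)])
    show "C m \<subseteq> cbox a b" "\<And>x. x \<in> C m \<Longrightarrow> \<bar>f x\<bar> \<le> L"
      using CN[of m] L(2) by auto
    fix u assume "u \<in> C m"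
    then have "u \<in> cbox a b - N"
      using CN by blast
    then obtain d where d: "d > 0" "\<forall>v\<in>cbox a b - N. \<forall>w\<in>cbox a b - N.
      (\<forall>k. \<bar>v $ k - u $ k\<bar> \<le> d \<and> \<bar>w $ k - u $ k\<bar> \<le> d \<and> (v $ k < u $ k \<longleftrightarrow> w $ k < u $ k)) \<longrightarrow> \<bar>f v - f w\<bar> \<le> \<rho> m"
      using osc[OF _ \<rho>[of m], of u] by (elim exE conjE meta_impE) (assumption, rule that)
    show "\<exists>d>0. \<forall>v\<in>C m. \<forall>w\<in>C m.
      (\<forall>k. \<bar>v $ k - u $ k\<bar> \<le> d \<and> \<bar>w $ k - u $ k\<bar> \<le> d \<and> (v $ k < u $ k \<longleftrightarrow> w $ k < u $ k)) \<longrightarrow> \<bar>f v - f w\<bar> \<le> \<rho> m"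
      using d CN[of m, THEN subsetD] by (intro exI[of _ d] conjI ballI) simp_all
  qed
  then have "\<forall>m. \<exists>g. step_function_on (cbox a b) g \<and> (\<forall>x\<in>C m. \<bar>g x - f x\<bar> \<le> \<rho> m) \<and> (\<forall>x. \<bar>g x\<bar> \<le> L)" ..
  then obtain g where "\<forall>m. step_function_on (cbox a b) (g m) \<and> (\<forall>x\<in>C m. \<bar>g m x - f x\<bar> \<le> \<rho> m) \<and> (\<forall>x. \<bar>g m x\<bar> \<le> L)"
    unfolding choice_iff ..
  then have g: "\<And>m. step_function_on (cbox a b) (g m)" "\<And>m x. x \<in> C m \<Longrightarrow> \<bar>g m x - f x\<bar> \<le> \<rho> m"
      "\<And>m x. \<bar>g m x\<bar> \<le> L"
    by simp_all
  have "nearly_uniform_limit (cbox a b) g f"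
    unfolding nearly_uniform_limit_def
  proof (intro conjI allI impI)
    show "\<exists>K. \<forall>m. \<forall>x\<in>cbox a b. \<bar>g m x\<bar> \<le> K"
      using g(3) by (intro exI[of _ L]) simp
    fix \<delta> :: real assume \<delta>: "\<delta> > 0"
    obtain \<B> where \<B>: "finite \<B>" "\<And>B. B \<in> \<B> \<Longrightarrow> is_brick B" "N \<subseteq> \<Union>\<B>" "(\<Sum>B\<in>\<B>. brick_volume B) < \<delta>"
      by (rule jordan_nullE[OF N \<delta>]) (rule that)
    obtain \<D> where \<D>: "finite \<D>" "\<And>D. D \<in> \<D> \<Longrightarrow> is_brick D" "open (\<Union>\<D>)" "closure (\<Union>\<B>) \<subseteq> \<Union>\<D>"
        "(\<Sum>D\<in>\<D>. brick_volume D) < \<delta>"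
      by (rule open_brick_cover[OF \<B>(1,2,4)]) (assumption, rule that)
    obtain \<C> where \<C>: "finite \<C>" "\<And>B. B \<in> \<C> \<Longrightarrow> is_brick B \<and> B \<subseteq> cbox a b"
        "(\<Sum>B\<in>\<C>. brick_volume B) \<le> (\<Sum>B\<in>\<D>. brick_volume B)" "\<Union>\<C> = cbox a b \<inter> \<Union>\<D>"
      by (rule restrict_brick_cover[OF \<D>(1,2) is_brick_cbox[OF le]]) (assumption, rule that)
    define X where "X = cbox a b - \<Union>\<D>"
    have "compact X"
      unfolding X_def by (intro compact_diff compact_cbox \<D>(3))
    moreover have "X \<inter> closure (\<Union>\<B>) = {}"
      using \<D>(4) by (auto simp: X_def)
    \<comment> \<open>Covering the closure, and not only \<open>N\<close>, makes a compact set and a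
      disjoint closed set available, whose distance is positive.\<close>
    ultimately have "\<exists>d>0. \<forall>x\<in>X. \<forall>y\<in>closure (\<Union>\<B>). d \<le> dist x y"
      by (intro separate_compact_closed closed_closure)
    then obtain d where d: "d > 0" "\<forall>x\<in>X. \<forall>y\<in>closure (\<Union>\<B>). d \<le> dist x y"
      by (elim exE conjE) (rule that)
    have XC: "X \<subseteq> C m" if m: "\<rho> m \<le> d" for m
    proof
      fix x assume x: "x \<in> X"
      have "d \<le> dist x y" if "y \<in> N" for y
        using d(2) x that \<B>(3) closure_subset[of "\<Union>\<B>"] by blast
      then have "x \<notin> ball y (\<rho> m)" if "y \<in> N" for y
        using m that by (fastforce simp: dist_commute)
      then show "x \<in> C m"
        using x by (auto simp: C_def X_def)
    qed
    have "uniform_limit X g f sequentially"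
      unfolding uniform_limit_iff
    proof (intro allI impI)
      fix e :: real assume e: "e > 0"
      have "\<rho> \<longlonglongrightarrow> 0"
        unfolding \<rho>_def by (rule LIMSEQ_inverse_real_of_nat)
      then have "\<forall>\<^sub>F m in sequentially. \<rho> m < min d e"
        using d(1) e by (intro order_tendstoD(2)) auto
      then show "\<forall>\<^sub>F m in sequentially. \<forall>x\<in>X. dist (g m x) (f x) < e"
      proof (rule eventually_mono, intro ballI)
        fix m x assume m: "\<rho> m < min d e" and "x \<in> X"
        then have "\<bar>g m x - f x\<bar> \<le> \<rho> m"
          by (intro g(2) XC[THEN subsetD]) simp_all
        then show "dist (g m x) (f x) < e"
          using m by (simp add: dist_real_def)
      qed
    qed
    moreover have "cbox a b - \<Union>\<C> = X"
      using \<C>(4) by (auto simp: X_def)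
    ultimately show "\<exists>\<B>. finite \<B> \<and> (\<forall>B\<in>\<B>. is_brick B \<and> B \<subseteq> cbox a b) \<and>
       (\<Sum>B\<in>\<B>. brick_volume B) < \<delta> \<and> uniform_limit (cbox a b - \<Union>\<B>) g f sequentially"
      using \<C>(1,2,3) \<D>(5) by (intro exI[of _ \<C>]) simp
  qed
  then show ?thesis
    by (rule K_integrable_onI[OF g(1)])
qed

section \<open>Recovering the set function from Riemann sums\<close>

lemma tagged_division_closed_subbricks:
  assumes S: "S \<in> closed_subbricks a b" and p: "p tagged_division_of S" "(x, K) \<in> p"
  shows "K \<in> closed_subbricks a b"
proof -
  obtain u v where uv: "K = cbox u v"
    using tagged_division_ofD(4)[OF p] by blast
  have "K \<noteq> {}" "K \<subseteq> S"
    using tagged_division_ofD(2,3)[OF p] by auto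
  then show ?thesis
    using S unfolding closed_subbricks_iff uv by blast
qed

lemma finitely_additive_tagged_division:
  assumes add: "finitely_additive a b \<Psi>" and S: "S \<in> closed_subbricks a b" and p: "p tagged_division_of S"
  shows "\<Psi> S = (\<Sum>(x, K)\<in>p. \<Psi> K)"
proof -
  note pD = tagged_division_ofD[OF p]
  \<comment> \<open>The tagged pairs are enumerated rather than the bricks: a degenerate brick may
    carry several tags and then appears several times in the sum.\<close>
  obtain h where h: "bij_betw h {1..card p} p"
    using ex_bij_betw_nat_finite_1[OF pD(1)] by blast
  have hp: "h i \<in> p" if "i \<in> {1..card p}" for i
    using bij_betw_apply[OF h that] .
  have "\<Psi> S = (\<Sum>i=1..card p. \<Psi> (snd (h i)))"
  proof (rule add[unfolded finitely_additive_def, rule_format], intro conjI ballI impI)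
    show "S \<in> closed_subbricks a b" by (rule S)
    show "snd (h i) \<in> closed_subbricks a b" if "i \<in> {1..card p}" for i
      by (rule tagged_division_closed_subbricks[OF S p, of "fst (h i)"]) (simp add: hp[OF that])
    have "S = (\<Union>x\<in>p. snd x)"
      using pD(6) by force
    also have "\<dots> = (\<Union>i\<in>{1..card p}. snd (h i))"
      using bij_betw_imp_surj_on[OF h] by (metis image_image)
    finally show "S = (\<Union>i\<in>{1..card p}. snd (h i))" .
    show "interior (snd (h i)) \<inter> interior (snd (h j)) = {}"
      if ij: "i \<in> {1..card p}" "j \<in> {1..card p}" "i \<noteq> j" for i j
    proof -
      have "h i \<noteq> h j"
        using bij_betw_imp_inj_on[OF h] ij by (auto dest: inj_onD)
      then show ?thesis
        using pD(5)[of "fst (h i)" "snd (h i)" "fst (h j)" "snd (h j)"] hp[OF ij(1)] hp[OF ij(2)]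
        by simp
    qed
  qed
  also have "\<dots> = (\<Sum>x\<in>p. \<Psi> (snd x))"
    by (rule sum.reindex_bij_betw[OF h])
  finally show ?thesis
    by (simp add: case_prod_beta)
qed

text \<open>At a tag outside \<open>Z\<close>, strong differentiability makes \<Psi>
  \<open>K\<close> and \<open>f x\<close> times the volume agree up to \<epsilon> times the volume.
  At a tag in \<open>Z\<close> the error is at most \<open>2 * L\<close> times the volume, and a
  gauge for the indicator of \<open>Z\<close> makes the total volume of such pieces small.\<close>

lemma has_integral_strong_derivative:
  fixes f :: "real ^ 'n \<Rightarrow> real"
  assumes add: "finitely_additive a b \<Psi>"
    and L: "L > 0" "\<And>S. S \<in> closed_subbricks a b \<Longrightarrow> \<bar>\<Psi> S\<bar> \<le> L * brick_volume S"
      "\<And>x. x \<in> cbox a b \<Longrightarrow> \<bar>f x\<bar> \<le> L"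
    and Z: "negligible Z" "\<And>u. u \<in> cbox a b - Z \<Longrightarrow> has_strong_derivative a b \<Psi> u (f u)"
    and S: "S \<in> closed_subbricks a b"
  shows "(f has_integral \<Psi> S) S"
proof -
  obtain \<alpha> \<beta> where c: "S = cbox \<alpha> \<beta>" "cbox \<alpha> \<beta> \<noteq> {}" "S \<subseteq> cbox a b"
    by (rule closed_subbricksE[OF S]) (rule that)
  have "(f has_integral \<Psi> S) (cbox \<alpha> \<beta>)"
    unfolding has_integral
  proof (intro allI impI)
    fix e :: real assume e: "e > 0"
    \<comment> \<open>Summed over a division this error is at most \<open>e / 2\<close>; the
      \<open>+ 1\<close> keeps the denominator positive for degenerate \<open>S\<close>.\<close>
    define \<epsilon> where "\<epsilon> = e / (2 * (brick_volume S + 1))"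
    have vol: "brick_volume S \<ge> 0"
      by (rule brick_volume_nonneg[OF closed_subbricks_brick[OF S]])
    then have \<epsilon>: "\<epsilon> > 0"
      using e by (simp add: \<epsilon>_def)
    \<comment> \<open>Multiplied by the error factor \<open>2 * L\<close>, this share becomes the
      other \<open>e / 2\<close>.\<close>
    have e4: "e / (4 * L) > 0"
      using e L(1) by simp
    have "(indicat_real Z has_integral 0) (cbox \<alpha> \<beta>)"
      using Z(1) by (simp add: negligible_def)
    from this[unfolded has_integral, THEN spec, THEN mp, OF e4]
    obtain \<gamma>0 where \<gamma>0: "gauge \<gamma>0" "\<forall>p. p tagged_division_of (cbox \<alpha> \<beta>) \<and> \<gamma>0 fine p \<longrightarrow>
        norm ((\<Sum>(x, K)\<in>p. measure lborel K *\<^sub>R indicat_real Z x) - 0) < e / (4 * L)"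
      by (elim exE conjE) (rule that)
    have "\<forall>u\<in>cbox a b - Z. \<exists>d. d > 0 \<and> (\<forall>K\<in>closed_subbricks a b.
        brick_volume K > 0 \<and> K \<subseteq> ball u d \<longrightarrow> \<bar>\<Psi> K / brick_volume K - f u\<bar> < \<epsilon>)"
      using Z(2) \<epsilon> by (simp add: has_strong_derivative_def)
    then have "\<exists>d. \<forall>u\<in>cbox a b - Z. d u > 0 \<and> (\<forall>K\<in>closed_subbricks a b.
        brick_volume K > 0 \<and> K \<subseteq> ball u (d u) \<longrightarrow> \<bar>\<Psi> K / brick_volume K - f u\<bar> < \<epsilon>)"
      by (rule bchoice)
    then obtain d where d: "\<forall>u\<in>cbox a b - Z. d u > 0 \<and> (\<forall>K\<in>closed_subbricks a b.
        brick_volume K > 0 \<and> K \<subseteq> ball u (d u) \<longrightarrow> \<bar>\<Psi> K / brick_volume K - f u\<bar> < \<epsilon>)" ..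
    define \<gamma>1 where "\<gamma>1 = (\<lambda>u. ball u (if u \<in> cbox a b - Z then d u else 1))"
    have "gauge \<gamma>1"
      using d by (auto simp: \<gamma>1_def gauge_def)
    then have gauge: "gauge (\<lambda>u. \<gamma>1 u \<inter> \<gamma>0 u)"
      using \<gamma>0(1) by (rule gauge_Int)
    have small: "norm ((\<Sum>(x, K)\<in>p. measure lborel K *\<^sub>R f x) - \<Psi> S) < e"
      if p: "p tagged_division_of (cbox \<alpha> \<beta>)" "(\<lambda>u. \<gamma>1 u \<inter> \<gamma>0 u) fine p" for p
    proof -
      note pD = tagged_division_ofD[OF p(1)]
      have fine: "\<gamma>1 fine p" "\<gamma>0 fine p"
        using p(2) by (auto simp: fine_Int)
      have bound: "\<bar>measure lborel K *\<^sub>R f x - \<Psi> K\<bar> \<le> measure lborel K * \<epsilon> + 2 * L * (measure lborel K *\<^sub>R indicat_real Z x)"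
        if xK: "(x, K) \<in> p" for x K
      proof -
        have K: "K \<in> closed_subbricks a b" "x \<in> cbox a b"
          using tagged_division_closed_subbricks[OF S p(1)[folded c(1)] xK] pD(2,3)[OF xK] c(1,3)
          by auto
        have cont: "measure lborel K = brick_volume K" "measure lborel K \<ge> 0"
          using closed_subbricks_content[OF K(1)] brick_volume_nonneg[OF closed_subbricks_brick[OF K(1)]]
          by simp_all
        show ?thesis
        \<comment> \<open>Pieces of volume zero join the exceptional case, since strong
          differentiability says nothing about them; there the Lipschitz bound forces both terms to
          vanish.\<close>
        proof (cases "x \<in> Z \<or> measure lborel K = 0")
          case True
          have "\<bar>measure lborel K * f x\<bar> \<le> L * measure lborel K"
            using mult_left_mono[OF L(3)[OF K(2)] cont(2)] cont(2) by (simp add: abs_mult mult.commute)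
          then have "\<bar>measure lborel K *\<^sub>R f x - \<Psi> K\<bar> \<le> 2 * L * measure lborel K"
            using L(2)[OF K(1)] cont(1) by simp
          moreover have "0 \<le> measure lborel K * \<epsilon>"
            using cont(2) \<epsilon> by simp
          ultimately show ?thesis
            using True by auto
        next
          case False
          then have pos: "brick_volume K > 0"
            using cont by simp
          have "K \<subseteq> ball x (d x)"
            using fineD[OF fine(1) xK] False K(2) by (simp add: \<gamma>1_def)
          then have "\<bar>\<Psi> K / brick_volume K - f x\<bar> < \<epsilon>"
            using d False K pos by simp
          moreover have "measure lborel K *\<^sub>R f x - \<Psi> K = - brick_volume K * (\<Psi> K / brick_volume K - f x)"
            using pos cont(1) by (simp add: field_simps)
          ultimately have "\<bar>measure lborel K *\<^sub>R f x - \<Psi> K\<bar> \<le> brick_volume K * \<epsilon>"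
            using pos by (simp add: abs_mult)
          then show ?thesis
            using False cont(1) by simp
        qed
      qed
      have "\<bar>(\<Sum>(x, K)\<in>p. measure lborel K *\<^sub>R f x) - \<Psi> S\<bar> = \<bar>\<Sum>(x, K)\<in>p. measure lborel K *\<^sub>R f x - \<Psi> K\<bar>"
        using finitely_additive_tagged_division[OF add S p(1)[folded c(1)]]
        by (simp add: sum_subtractf case_prod_beta)
      also have "\<dots> \<le> (\<Sum>(x, K)\<in>p. measure lborel K * \<epsilon> + 2 * L * (measure lborel K *\<^sub>R indicat_real Z x))"
        using bound by (intro order_trans[OF sum_abs sum_mono]) auto
      also have "\<dots> = (\<Sum>(x, K)\<in>p. measure lborel K) * \<epsilon> + 2 * L * (\<Sum>(x, K)\<in>p. measure lborel K *\<^sub>R indicat_real Z x)"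
        by (simp add: sum.distrib sum_distrib_left sum_distrib_right case_prod_beta)
      also have "(\<Sum>(x, K)\<in>p. measure lborel K) = brick_volume S"
        using additive_content_tagged_division[OF p(1)] closed_subbricks_content[OF S] c(1) by simp
      also have "brick_volume S * \<epsilon> + 2 * L * (\<Sum>(x, K)\<in>p. measure lborel K *\<^sub>R indicat_real Z x) < e"
      proof -
        have "brick_volume S * \<epsilon> \<le> e / 2"
          using vol e by (simp add: \<epsilon>_def field_simps)
        moreover have "(\<Sum>(x, K)\<in>p. measure lborel K *\<^sub>R indicat_real Z x) < e / (4 * L)"
          using \<gamma>0(2)[THEN spec, THEN mp, OF conjI, OF p(1) fine(2)] unfolding real_norm_def by linarith
        then have "2 * L * (\<Sum>(x, K)\<in>p. measure lborel K *\<^sub>R indicat_real Z x) < e / 2"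
          using L(1) by (simp add: field_simps)
        ultimately show ?thesis by linarith
      qed
      finally show ?thesis by simp
    qed
    show "\<exists>\<gamma>. gauge \<gamma> \<and> (\<forall>p. p tagged_division_of (cbox \<alpha> \<beta>) \<and> \<gamma> fine p \<longrightarrow>
        norm ((\<Sum>(x, K)\<in>p. measure lborel K *\<^sub>R f x) - \<Psi> S) < e)"
      by (intro exI[of _ "\<lambda>u. \<gamma>1 u \<inter> \<gamma>0 u"] conjI allI impI gauge) (elim conjE, rule small)
  qed
  then show ?thesis
    by (simp add: c(1))
qed

section \<open>The directional derivative as integrand\<close>

text \<open>The integrand is the derivative in the direction (1, ..., 1). For \<open>v\<close> near
  \<open>u\<close>, small bricks with lower corner \<open>v\<close> lie in the closed quadrant of
  \<open>u\<close> selected by the signs of \<open>v - u\<close>, so \<open>f v\<close> is near the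
  derivative of \<Psi> at \<open>u\<close> in that direction. This is the oscillation condition for
  K-integrability.\<close>

lemma strongly_differentiable_dir_imp_K_integrable:
  fixes a b :: "real ^ 'n"
  assumes le: "\<And>i. a $ i \<le> b $ i"
    and L: "L > 0" "\<And>S. S \<in> closed_subbricks a b \<Longrightarrow> \<bar>\<Psi> S\<bar> \<le> L * brick_volume S"
    and N: "jordan_null {u \<in> cbox a b. \<exists>\<alpha>\<in>directions. \<not> strongly_differentiable_dir a b \<Psi> \<alpha> u}"
  obtains f where "f K_integrable_on cbox a b" "\<And>u. \<bar>f u\<bar> \<le> L"
    "\<And>u t. has_strong_derivative_dir a b \<Psi> (\<chi> k. 1) u t \<Longrightarrow> f u = t"
proof -
  \<comment> \<open>The default zero keeps \<open>f\<close> bounded by \<open>L\<close>; off the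
    boundary and the interior exceptional points it is never taken inside the closed brick.\<close>
  define f where "f = (\<lambda>u. if strongly_differentiable_dir a b \<Psi> (\<chi> k. 1) u
    then (SOME t. has_strong_derivative_dir a b \<Psi> (\<chi> k. 1) u t) else 0)"
  have some: "has_strong_derivative_dir a b \<Psi> (\<chi> k. 1) u (f u)"
    if "strongly_differentiable_dir a b \<Psi> (\<chi> k. 1) u" for u
    using that someI_ex[of "has_strong_derivative_dir a b \<Psi> (\<chi> k. 1) u"]
    by (simp add: f_def strongly_differentiable_dir_def)
  have eq: "f u = t" if "has_strong_derivative_dir a b \<Psi> (\<chi> k. 1) u t" for u t
    using some strong_derivative_dir_unique that unfolding strongly_differentiable_dir_def by blast
  have f_le: "\<bar>f u\<bar> \<le> L" for u
  proof (cases "strongly_differentiable_dir a b \<Psi> (\<chi> k. 1) u")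
    case True
    have "\<bar>f u - 0\<bar> \<le> L"
    proof (rule strong_derivative_dir_close[OF some[OF True] open_UNIV UNIV_I])
      fix S assume "S \<in> closed_subbricks a b" "brick_volume S > 0"
      then show "\<bar>\<Psi> S / brick_volume S - 0\<bar> \<le> L"
        using L(2)[of S] by (simp add: abs_divide divide_le_eq)
    qed
    then show ?thesis by simp
  qed (use L(1) in \<open>simp add: f_def\<close>)
  define N where "N = {u \<in> cbox a b. \<exists>\<alpha>\<in>directions. \<not> strongly_differentiable_dir a b \<Psi> \<alpha> u}"
  have dir: "strongly_differentiable_dir a b \<Psi> \<alpha> u" if "u \<in> cbox a b - N" "\<alpha> \<in> directions" for u \<alpha>
    using that by (auto simp: N_def)
  have ones: "(\<chi> k. 1) \<in> directions"
    by (simp add: directions_def)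
  \<comment> \<open>Sign patterns are kept as predicates, true where \<open>v\<close> is below
    \<open>u\<close>, and translated into directions.\<close>
  define dirv where "dirv = (\<lambda>\<sigma> :: 'n \<Rightarrow> bool. \<chi> k. if \<sigma> k then -1 else (1 :: int))"
  have dirv: "dirv \<sigma> \<in> directions" "dirv \<sigma> $ k = -1 \<longleftrightarrow> \<sigma> k" for \<sigma> k
    by (simp_all add: dirv_def directions_def)
  \<comment> \<open>Points with \<open>v $ k = u $ k\<close> count as lying in the positive direction, because the bricks with
    lower corner \<open>v\<close> used to compute \<open>f v\<close> extend in the direction \<open>(1, \<dots>, 1)\<close>.\<close>
  have osc: "\<exists>d>0. \<forall>v\<in>cbox a b - N. \<forall>w\<in>cbox a b - N.
      (\<forall>k. \<bar>v $ k - u $ k\<bar> \<le> d \<and> \<bar>w $ k - u $ k\<bar> \<le> d \<and> (v $ k < u $ k \<longleftrightarrow> w $ k < u $ k)) \<longrightarrow> \<bar>f v - f w\<bar> \<le> e"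
    if u: "u \<in> cbox a b - N" and e: "e > 0" for u e
  proof -
    have box: "u \<in> box a b"
      using dir[OF u ones] by (auto simp: strongly_differentiable_dir_def has_strong_derivative_dir_def)
    have "\<forall>\<sigma>. \<exists>t. has_strong_derivative_dir a b \<Psi> (dirv \<sigma>) u t"
      using dir[OF u dirv(1)] by (simp add: strongly_differentiable_dir_def)
    then obtain t where t: "\<forall>\<sigma>. has_strong_derivative_dir a b \<Psi> (dirv \<sigma>) u (t \<sigma>)"
      unfolding choice_iff ..
    have "\<forall>\<sigma>. \<exists>\<delta>. \<delta> > 0 \<and> (\<forall>S\<in>closed_subbricks a b. brick_volume S > 0 \<and>
        S \<subseteq> ball u \<delta> \<inter> closure (quadrant a b u (dirv \<sigma>)) \<longrightarrow> \<bar>\<Psi> S / brick_volume S - t \<sigma>\<bar> < e / 2)"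
    proof
      fix \<sigma>
      have "e / 2 > 0" using e by simp
      from t[THEN spec, of \<sigma>, unfolded has_strong_derivative_dir_def, THEN conjunct2, THEN spec, THEN mp, OF this]
      show "\<exists>\<delta>. \<delta> > 0 \<and> (\<forall>S\<in>closed_subbricks a b. brick_volume S > 0 \<and>
        S \<subseteq> ball u \<delta> \<inter> closure (quadrant a b u (dirv \<sigma>)) \<longrightarrow> \<bar>\<Psi> S / brick_volume S - t \<sigma>\<bar> < e / 2)" .
    qed
    then obtain \<delta> where \<delta>: "\<forall>\<sigma>. \<delta> \<sigma> > 0 \<and> (\<forall>S\<in>closed_subbricks a b. brick_volume S > 0 \<and>
        S \<subseteq> ball u (\<delta> \<sigma>) \<inter> closure (quadrant a b u (dirv \<sigma>)) \<longrightarrow> \<bar>\<Psi> S / brick_volume S - t \<sigma>\<bar> < e / 2)"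
      unfolding choice_iff ..
    \<comment> \<open>There are only finitely many sign patterns, so one positive radius serves all
      directions.\<close>
    define r where "r = Min (range \<delta>)"
    have r: "r > 0" "r \<le> \<delta> \<sigma>" for \<sigma>
      using \<delta> by (simp_all add: r_def)
    \<comment> \<open>By the sum bound for the norm, coordinate distances of at most
      \<open>d\<close> give Euclidean distance at most \<open>r / 2\<close>.\<close>
    define d where "d = r / (2 * CARD('n))"
    have d: "d > 0"
      using r(1) by (simp add: d_def)
    have near: "\<bar>f v - t (\<lambda>k. v $ k < u $ k)\<bar> \<le> e / 2"
      if v: "v \<in> cbox a b - N" "\<And>k. \<bar>v $ k - u $ k\<bar> \<le> d" for v
    proof -
      define \<sigma> where "\<sigma> = (\<lambda>k. v $ k < u $ k)"
      have "norm (v - u) \<le> (\<Sum>k\<in>UNIV. \<bar>(v - u) $ k\<bar>)"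
        by (rule norm_le_l1_cart)
      also have "\<dots> \<le> (\<Sum>k\<in>(UNIV :: 'n set). d)"
        using v(2) by (intro sum_mono) simp
      also have "\<dots> = r / 2"
        by (simp add: d_def)
      finally have "v \<in> ball u (\<delta> \<sigma>)"
        using r(1) r(2)[of \<sigma>] by (simp add: dist_norm norm_minus_commute)
      \<comment> \<open>In the coordinates where \<open>v\<close> is below \<open>u\<close>, a brick
        starting at \<open>v\<close> could cross the hyperplane through \<open>u\<close>; this open
        set prevents that.\<close>
      moreover define V where "V = (\<Inter>k\<in>{k. \<sigma> k}. {x. x $ k < u $ k})"
      have "open V"
        unfolding V_def by (intro open_INT finite ballI open_halfspace_component_lt_cart)
      moreover have "v \<in> V"
        by (simp add: V_def \<sigma>_def)
      ultimately have U: "open (ball u (\<delta> \<sigma>) \<inter> V)" "v \<in> ball u (\<delta> \<sigma>) \<inter> V"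
        by (auto intro: open_Int)
      have "\<bar>f v - t \<sigma>\<bar> \<le> e / 2"
      proof (rule strong_derivative_dir_close[OF some[OF dir[OF v(1) ones]] U])
        fix S assume S: "S \<in> closed_subbricks a b" "brick_volume S > 0"
          "S \<subseteq> ball u (\<delta> \<sigma>) \<inter> V" "S \<subseteq> cbox v b"
        have "S \<subseteq> cbox (quadrant_lo a u (dirv \<sigma>)) (quadrant_hi b u (dirv \<sigma>))"
        proof
          fix x assume x: "x \<in> S"
          have "quadrant_lo a u (dirv \<sigma>) $ k \<le> x $ k \<and> x $ k \<le> quadrant_hi b u (dirv \<sigma>) $ k" for k
          proof -
            have "x \<in> cbox a b" "x \<in> cbox v b" "x \<in> V"
              using x S(1,3,4) by (auto simp: closed_subbricks_iff)
            then have "a $ k \<le> x $ k" "x $ k \<le> b $ k" "v $ k \<le> x $ k" "\<sigma> k \<Longrightarrow> x $ k < u $ k"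
              by (simp_all add: mem_box_cart V_def)
            then show ?thesis
              by (cases "\<sigma> k") (simp_all add: quadrant_lo_def quadrant_hi_def dirv(2), simp add: \<sigma>_def)
          qed
          then show "x \<in> cbox (quadrant_lo a u (dirv \<sigma>)) (quadrant_hi b u (dirv \<sigma>))"
            by (simp add: mem_box_cart)
        qed
        then have "S \<subseteq> ball u (\<delta> \<sigma>) \<inter> closure (quadrant a b u (dirv \<sigma>))"
          using S(3) by (simp add: closure_quadrant[OF box])
        then show "\<bar>\<Psi> S / brick_volume S - t \<sigma>\<bar> \<le> e / 2"
          using \<delta> S(1,2) by (simp add: less_imp_le)
      qed
      then show ?thesis
        by (simp add: \<sigma>_def)
    qed
    have "\<bar>f v - f w\<bar> \<le> e" if vw: "v \<in> cbox a b - N" "w \<in> cbox a b - N"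
      "\<forall>k. \<bar>v $ k - u $ k\<bar> \<le> d \<and> \<bar>w $ k - u $ k\<bar> \<le> d \<and> (v $ k < u $ k \<longleftrightarrow> w $ k < u $ k)" for v w
    proof -
      have eq: "(\<lambda>k. v $ k < u $ k) = (\<lambda>k. w $ k < u $ k)"
        using vw(3) by simp
      have "\<bar>f v - t (\<lambda>k. v $ k < u $ k)\<bar> \<le> e / 2" "\<bar>f w - t (\<lambda>k. w $ k < u $ k)\<bar> \<le> e / 2"
        using vw(3) by (intro near vw; simp)+
      then show ?thesis
        unfolding eq by linarith
    qed
    then show ?thesis
      using d by blast
  qed
  have "f K_integrable_on cbox a b"
    by (rule K_integrable_if_small_oscillation[OF le N[folded N_def] less_imp_le[OF L(1)] f_le osc])
  then show thesis
    using that[of f] f_le eq by blast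
qed

section \<open>Both implications of the characterization\<close>

theorem theorem5p4:
  fixes a b :: "real ^ 'n" and \<Psi> :: "(real ^ 'n) set \<Rightarrow> real"
  assumes "\<forall>i. a $ i \<le> b $ i"
  shows "(\<exists>f :: real ^ 'n \<Rightarrow> real. f K_integrable_on cbox a b \<and>
            (\<forall>S\<in>closed_subbricks a b. \<Psi> S = K_integral S f))
     \<longleftrightarrow>
         brick_lipschitz a b \<Psi> \<and>
         finitely_additive a b \<Psi> \<and>
         (AE u in lebesgue_on (cbox a b). strongly_differentiable a b \<Psi> u) \<and>
         jordan_null {u \<in> cbox a b. \<exists>\<alpha>\<in>directions. \<not> strongly_differentiable_dir a b \<Psi> \<alpha> u}"
    (is "?L \<longleftrightarrow> ?R")
proof -
  have le: "\<And>i. a $ i \<le> b $ i"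
    using assms by simp
  have AE: "(AE u in lebesgue_on (cbox a b). strongly_differentiable a b \<Psi> u) \<longleftrightarrow>
      negligible {u \<in> cbox a b. \<not> strongly_differentiable a b \<Psi> u}"
    by (intro AE_lebesgue_on_iff_negligible) simp
  have sub: "is_brick S" "S \<subseteq> cbox a b" if "S \<in> closed_subbricks a b" for S
    using closed_subbricks_brick[OF that] that[unfolded closed_subbricks_iff] by simp_all
  have K: "f K_integrable_on S" "K_integral S f = integral S f" "f integrable_on S"
    if "f K_integrable_on cbox a b" "S \<in> closed_subbricks a b" for f S
    using K_integrable_on_subbrick[OF that(1) sub[OF that(2)]] sub(1)[OF that(2)]
    by (simp_all add: K_integral_eq_integral K_integrable_imp_integrable)
  show ?thesis
  proof
    assume ?L
    then obtain f where f: "f K_integrable_on cbox a b" "\<forall>S\<in>closed_subbricks a b. \<Psi> S = K_integral S f"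
      by (elim exE conjE) (rule that)
    then have \<Psi>: "\<And>S. S \<in> closed_subbricks a b \<Longrightarrow> \<Psi> S = integral S f"
      using K(2)[OF f(1)] by simp
    show ?R
      using K_integrable_brick_lipschitz[OF f(1) \<Psi>] integral_finitely_additive[OF K(3)[OF f(1)] \<Psi>]
        K_integrable_strongly_differentiable[OF le f(1) \<Psi>]
      by (simp only: AE simp_thms)
  next
    assume R: ?R
    then obtain L where L: "L > 0" "\<And>S. S \<in> closed_subbricks a b \<Longrightarrow> \<bar>\<Psi> S\<bar> \<le> L * brick_volume S"
      by (auto simp: brick_lipschitz_def)
    have N: "jordan_null {u \<in> cbox a b. \<exists>\<alpha>\<in>directions. \<not> strongly_differentiable_dir a b \<Psi> \<alpha> u}"
      and add: "finitely_additive a b \<Psi>"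
      and Z: "negligible {u \<in> cbox a b. \<not> strongly_differentiable a b \<Psi> u}" (is "negligible ?Z")
      using R by (simp_all only: AE simp_thms)
    obtain f where f: "f K_integrable_on cbox a b" "\<And>u. \<bar>f u\<bar> \<le> L"
      "\<And>u t. has_strong_derivative_dir a b \<Psi> (\<chi> k. 1) u t \<Longrightarrow> f u = t"
      by (rule strongly_differentiable_dir_imp_K_integrable[OF le L N]) (assumption | rule that)+
    have deriv: "has_strong_derivative a b \<Psi> u (f u)" if u: "u \<in> cbox a b - ?Z" for u
    proof -
      obtain t where t: "has_strong_derivative a b \<Psi> u t"
        using u by (auto simp: strongly_differentiable_def)
      \<comment> \<open>Restricting the test bricks to a closed quadrant only weakens the
        requirement, so the full derivative is also the one in the direction (1, ..., 1) and equals
        \<open>f u\<close>.\<close>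
      have "has_strong_derivative_dir a b \<Psi> (\<chi> k. 1) u t"
        using t unfolding has_strong_derivative_def has_strong_derivative_dir_def by (simp add: le_inf_iff) meson
      then show ?thesis
        using f(3) t by simp
    qed
    have "\<Psi> S = K_integral S f" if S: "S \<in> closed_subbricks a b" for S
      using has_integral_strong_derivative[OF add L f(2) Z deriv S] K(2)[OF f(1) S]
      by (simp add: integral_unique)
    then show ?L
      using f(1) by blast
  qed
qed

end
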